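(* Let $\varphi:\mathbb{R}\to\mathbb{R}$ be a polynomial with $\deg(\varphi)\ge2$. The following are equivalent. (a) $\varphi$ does not have fixed points (hence, $\varphi$ is of even degree). (b) $C_\varphi$ is power bounded on $\mathscr{S}(\mathbb{R})$. (c) $C_\varphi$ is (uniformly) mean ergodic on $\mathscr{S}(\mathbb{R})$. (d) $(C_\varphi^n)_{n\in\mathbb{N}}$ converges to $0$ in $\mathcal{L}_b(\mathscr{S}(\mathbb{R}))$. (e) $C_\varphi$ is Cesàro bounded on $\mathscr{S}(\mathbb{R})$, i.e. the sequence $\left(\frac1n\sum_{m=1}^nC_\varphi^m\right)_{n\in\mathbb{N}}$ is bounded in $\mathcal{L}_b(\mathscr{S}(\mathbb{R}))$. (f) $C_{\psi,\varphi}$ is power bounded on $\mathscr{S}(\mathbb{R})$ for every $\psi\in\mathscr{O}_M(\mathbb{R})$ and/or for every smooth $\psi$ of small decay with respect to $\varphi$. (g) $(C_{\psi,\varphi}^n)_{n\in\mathbb{N}}$ is convergent to $0$ in $\mathcal{L}_b(\mathscr{S}(\mathbb{R}))$ for every $\psi\in\mathscr{O}_M(\mathbb{R})$ and/or for every smooth $\psi$ of small decay with respect to $\varphi$. (h) $C_{\psi,\varphi}$ is (uniformly) mean ergodic on $\mathscr{S}(\mathbb{R})$ for every $\psi\in\mathscr{O}_M(\mathbb{R})$ and/or for every smooth $\psi$ of small decay with respect to $\varphi$.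
   Context: $\mathscr{S}(\mathbb{R})$ is the Schwartz space of complex-valued rapidly decreasing smooth functions with its standard Fréchet topology. $\mathscr{O}_M(\mathbb{R})$ is the space of multipliers of $\mathscr{S}(\mathbb{R})$: all $\psi\in C^\infty(\mathbb{R})$ (complex-valued) such that for every $\gamma\in\mathbb{N}_0$ there is $r>0$ with $\sup_x(1+|x|)^{-r}|\psi^{(\gamma)}(x)|<\infty$. $C_{\psi,\varphi}f=\psi\cdot(f\circ\varphi)$ is the weighted composition operator and $C_\varphi=C_{1,\varphi}$ the composition operator. For a polynomial $\varphi$ with $\deg\varphi\ge2$, $C_\varphi$ maps $\mathscr{S}(\mathbb{R})$ continuously into itself. A function $\psi\in C^\infty(\mathbb{R})$ (complex-valued) is of small decay with respect to $\varphi$ if there is $m>0$ with $\inf_{|x|\ge m}(1+|x|)^m(1+|\varphi(x)|)^m|\psi(x)|>0$. For a continuous linear operator $T$ on a locally convex Hausdorff space $E$: $T$ is power bounded if $\{T^n:n\in\mathbb{N}\}$ is equicontinuous; $T$ is mean ergodic if $\left(\frac1n\sum_{m=1}^nT^mx\right)_{n\in\mathbb{N}}$ converges in $E$ for every $x\in E$; $T$ is uniformly mean ergodic if these Cesàro means converge uniformly on bounded subsets of $E$. $\mathcal{L}_b(E)$ is the space of continuous linear operators on $E$ with the topology of uniform convergence on bounded sets. "And/or" and "(uniformly)" indicate variants of a condition, each of which belongs to the list of equivalent conditions.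
   Formalization: In (f), (g), (h), "every smooth ψ of small decay" is restricted to those ψ for which C_{ψ,φ} is a continuous linear operator on S(R); without this the claim fails, e.g. φ = x²+1, ψ = exp(x⁶). *)

theory Defs
  imports "HOL-Analysis.Analysis" "HOL-Computational_Algebra.Polynomial"
begin

section \<open>Locally convex spaces given by a family of seminorms\<close>

text \<open>
  A locally convex space is given by its carrier \<open>E\<close> and a family \<open>P\<close> of seminorms on \<open>E\<close>
  generating its topology. Only the subtraction of the ambient type is needed for this, so that the
  same definition serves for spaces of functions and for spaces of operators between them.
\<close>

definition seminorm_open :: "'a::minus set \<Rightarrow> ('a \<Rightarrow> real) set \<Rightarrow> 'a set \<Rightarrow> bool" where
  "seminorm_open E P U \<longleftrightarrow> U \<subseteq> E \<and>
     (\<forall>x\<in>U. \<exists>F e. finite F \<and> F \<subseteq> P \<and> 0 < e \<and> {y \<in> E. \<forall>p\<in>F. p (y - x) < e} \<subseteq> U)"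

definition seminorm_topology :: "'a::minus set \<Rightarrow> ('a \<Rightarrow> real) set \<Rightarrow> 'a topology" where
  "seminorm_topology E P = topology (seminorm_open E P)"

lemma istopology_seminorm_open: "istopology (seminorm_open E P)"
  unfolding istopology_def
proof (intro conjI allI impI)
  fix U V assume U: "seminorm_open E P U" and V: "seminorm_open E P V"
  show "seminorm_open E P (U \<inter> V)"
    unfolding seminorm_open_def
  proof (intro conjI ballI)
    show "U \<inter> V \<subseteq> E" using U unfolding seminorm_open_def by blast
    fix x assume x: "x \<in> U \<inter> V"
    obtain F d where F: "finite F" "F \<subseteq> P" "0 < d" "{y \<in> E. \<forall>p\<in>F. p (y - x) < d} \<subseteq> U"
      using U x unfolding seminorm_open_def by blast
    obtain G e where G: "finite G" "G \<subseteq> P" "0 < e" "{y \<in> E. \<forall>p\<in>G. p (y - x) < e} \<subseteq> V"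
      using V x unfolding seminorm_open_def by blast
    have "finite (F \<union> G) \<and> F \<union> G \<subseteq> P \<and> 0 < min d e \<and>
        {y \<in> E. \<forall>p\<in>F \<union> G. p (y - x) < min d e} \<subseteq> U \<inter> V"
      using F G by auto
    then show "\<exists>F e. finite F \<and> F \<subseteq> P \<and> 0 < e \<and> {y \<in> E. \<forall>p\<in>F. p (y - x) < e} \<subseteq> U \<inter> V"
      by blast
  qed
next
  fix K assume K: "\<forall>U\<in>K. seminorm_open E P U"
  show "seminorm_open E P (\<Union>K)"
    unfolding seminorm_open_def
  proof (intro conjI ballI)
    show "\<Union>K \<subseteq> E" using K unfolding seminorm_open_def by blast
    fix x assume "x \<in> \<Union>K"
    then obtain U where U: "U \<in> K" "x \<in> U" by blast
    then have "seminorm_open E P U" using K by blast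
    then obtain F e where F: "finite F" "F \<subseteq> P" "0 < e" "{y \<in> E. \<forall>p\<in>F. p (y - x) < e} \<subseteq> U"
      using U(2) unfolding seminorm_open_def by blast
    have "{y \<in> E. \<forall>p\<in>F. p (y - x) < e} \<subseteq> \<Union>K"
      using F(4) U(1) by (rule subset_trans[OF _ Union_upper])
    then show "\<exists>F e. finite F \<and> F \<subseteq> P \<and> 0 < e \<and> {y \<in> E. \<forall>p\<in>F. p (y - x) < e} \<subseteq> \<Union>K"
      using F(1-3) by (intro exI[of _ F] exI[of _ e] conjI)
  qed
qed

lemma openin_seminorm_topology: "openin (seminorm_topology E P) = seminorm_open E P"
  unfolding seminorm_topology_def by (simp add: istopology_seminorm_open)

lemma topspace_seminorm_topology [simp]: "topspace (seminorm_topology E P) = E"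
proof (rule antisym)
  have "seminorm_open E P (topspace (seminorm_topology E P))"
    using openin_topspace[of "seminorm_topology E P"] by (simp only: openin_seminorm_topology)
  then show "topspace (seminorm_topology E P) \<subseteq> E"
    unfolding seminorm_open_def by (rule conjunct1)
  have "\<exists>F e. finite F \<and> F \<subseteq> P \<and> 0 < e \<and> {y \<in> E. \<forall>p\<in>F. p (y - x) < e} \<subseteq> E" for x
    by (rule exI[of _ "{}"], rule exI[of _ 1]) simp
  then have "seminorm_open E P E"
    unfolding seminorm_open_def by simp
  then have "openin (seminorm_topology E P) E"
    by (simp only: openin_seminorm_topology)
  then show "E \<subseteq> topspace (seminorm_topology E P)"
    by (rule openin_subset)
qed

definition seminorm_bounded :: "'a set \<Rightarrow> ('a \<Rightarrow> real) set \<Rightarrow> 'a set \<Rightarrow> bool" where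
  "seminorm_bounded E P B \<longleftrightarrow> B \<subseteq> E \<and> (\<forall>p\<in>P. bdd_above (p ` B))"


section \<open>Continuous linear operators on spaces of complex-valued functions\<close>

text \<open>
  Operators are total functions on the ambient function type; only their restriction to \<open>E\<close> is
  relevant, and in the space of operators two operators that agree on \<open>E\<close> are topologically
  indistinguishable.
\<close>

type_synonym 'x operator = "('x \<Rightarrow> complex) \<Rightarrow> ('x \<Rightarrow> complex)"

definition operators ::
    "('x \<Rightarrow> complex) set \<Rightarrow> (('x \<Rightarrow> complex) \<Rightarrow> real) set \<Rightarrow> 'x operator set" where
  "operators E P = {T. T ` E \<subseteq> E \<and>
     (\<forall>f\<in>E. \<forall>g\<in>E. \<forall>a b. T (\<lambda>x. a * f x + b * g x) = (\<lambda>x. a * T f x + b * T g x)) \<and>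
     continuous_map (seminorm_topology E P) (seminorm_topology E P) T}"

text \<open>
  The topology of uniform convergence on bounded sets is generated by the seminorms
  \<open>sup\<^bsub>f \<in> B\<^esub> p (T f)\<close>. The empty set is excluded because \<open>Sup {}\<close> is unspecified on the reals.
\<close>

definition Lb_seminorms ::
    "('x \<Rightarrow> complex) set \<Rightarrow> (('x \<Rightarrow> complex) \<Rightarrow> real) set \<Rightarrow> ('x operator \<Rightarrow> real) set" where
  "Lb_seminorms E P =
     {(\<lambda>T. SUP f\<in>B. p (T f)) | B p. seminorm_bounded E P B \<and> B \<noteq> {} \<and> p \<in> P}"

definition Lb_topology ::
    "('x \<Rightarrow> complex) set \<Rightarrow> (('x \<Rightarrow> complex) \<Rightarrow> real) set \<Rightarrow> 'x operator topology" where
  "Lb_topology E P = seminorm_topology (operators E P) (Lb_seminorms E P)"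

definition Lb_bounded ::
    "('x \<Rightarrow> complex) set \<Rightarrow> (('x \<Rightarrow> complex) \<Rightarrow> real) set \<Rightarrow> 'x operator set \<Rightarrow> bool" where
  "Lb_bounded E P = seminorm_bounded (operators E P) (Lb_seminorms E P)"

text \<open>For linear operators equicontinuity only needs to be required at the origin.\<close>

definition equicontinuous ::
    "('x \<Rightarrow> complex) set \<Rightarrow> (('x \<Rightarrow> complex) \<Rightarrow> real) set \<Rightarrow> 'x operator set \<Rightarrow> bool" where
  "equicontinuous E P H \<longleftrightarrow> H \<subseteq> operators E P \<and>
     (\<forall>V. openin (seminorm_topology E P) V \<and> (\<lambda>x. 0) \<in> V \<longrightarrow>
        (\<exists>U. openin (seminorm_topology E P) U \<and> (\<lambda>x. 0) \<in> U \<and> (\<forall>T\<in>H. T ` U \<subseteq> V)))"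

definition power_bounded ::
    "('x \<Rightarrow> complex) set \<Rightarrow> (('x \<Rightarrow> complex) \<Rightarrow> real) set \<Rightarrow> 'x operator \<Rightarrow> bool" where
  "power_bounded E P T \<longleftrightarrow> T \<in> operators E P \<and> equicontinuous E P {T ^^ n | n. n \<ge> 1}"

definition cesaro_mean :: "'x operator \<Rightarrow> nat \<Rightarrow> 'x operator" where
  "cesaro_mean T n = (\<lambda>f x. (\<Sum>m=1..n. (T ^^ m) f x) / of_nat n)"

definition mean_ergodic ::
    "('x \<Rightarrow> complex) set \<Rightarrow> (('x \<Rightarrow> complex) \<Rightarrow> real) set \<Rightarrow> 'x operator \<Rightarrow> bool" where
  "mean_ergodic E P T \<longleftrightarrow> T \<in> operators E P \<and>
     (\<forall>f\<in>E. \<exists>g. limitin (seminorm_topology E P) (\<lambda>n. cesaro_mean T n f) g sequentially)"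

definition uniformly_mean_ergodic ::
    "('x \<Rightarrow> complex) set \<Rightarrow> (('x \<Rightarrow> complex) \<Rightarrow> real) set \<Rightarrow> 'x operator \<Rightarrow> bool" where
  "uniformly_mean_ergodic E P T \<longleftrightarrow> T \<in> operators E P \<and>
     (\<exists>S. S ` E \<subseteq> E \<and>
        (\<forall>B V. seminorm_bounded E P B \<and> openin (seminorm_topology E P) V \<and> (\<lambda>x. 0) \<in> V \<longrightarrow>
           (\<forall>\<^sub>F n in sequentially. \<forall>f\<in>B. cesaro_mean T n f - S f \<in> V)))"

definition cesaro_bounded ::
    "('x \<Rightarrow> complex) set \<Rightarrow> (('x \<Rightarrow> complex) \<Rightarrow> real) set \<Rightarrow> 'x operator \<Rightarrow> bool" where
  "cesaro_bounded E P T \<longleftrightarrow> T \<in> operators E P \<and> Lb_bounded E P {cesaro_mean T n | n. n \<ge> 1}"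

definition powers_tendsto_zero ::
    "('x \<Rightarrow> complex) set \<Rightarrow> (('x \<Rightarrow> complex) \<Rightarrow> real) set \<Rightarrow> 'x operator \<Rightarrow> bool" where
  "powers_tendsto_zero E P T \<longleftrightarrow> T \<in> operators E P \<and>
     limitin (Lb_topology E P) (\<lambda>n. T ^^ n) (\<lambda>f x. 0) sequentially"


section \<open>The Schwartz space and its multipliers\<close>

definition nth_deriv :: "nat \<Rightarrow> (real \<Rightarrow> complex) \<Rightarrow> real \<Rightarrow> complex" where
  "nth_deriv n f = ((\<lambda>g x. vector_derivative g (at x)) ^^ n) f"

definition smooth :: "(real \<Rightarrow> complex) \<Rightarrow> bool" where
  "smooth f \<longleftrightarrow> (\<forall>n x. nth_deriv n f differentiable (at x))"

definition schwartz :: "(real \<Rightarrow> complex) set" where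
  "schwartz = {f. smooth f \<and>
     (\<forall>k j. bdd_above (range (\<lambda>x. (1 + \<bar>x\<bar>) ^ k * norm (nth_deriv j f x))))}"

definition schwartz_seminorm :: "nat \<Rightarrow> nat \<Rightarrow> (real \<Rightarrow> complex) \<Rightarrow> real" where
  "schwartz_seminorm k j f = (SUP x. (1 + \<bar>x\<bar>) ^ k * norm (nth_deriv j f x))"

definition schwartz_seminorms :: "((real \<Rightarrow> complex) \<Rightarrow> real) set" where
  "schwartz_seminorms = {schwartz_seminorm k j | k j. True}"

definition multipliers :: "(real \<Rightarrow> complex) set" where
  "multipliers = {\<psi>. smooth \<psi> \<and>
     (\<forall>j. \<exists>r>0. bdd_above (range (\<lambda>x. (1 + \<bar>x\<bar>) powr (- r) * norm (nth_deriv j \<psi> x))))}"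


section \<open>Weighted composition operators\<close>

definition weighted_comp :: "(real \<Rightarrow> complex) \<Rightarrow> (real \<Rightarrow> real) \<Rightarrow> real operator" where
  "weighted_comp \<psi> \<phi> f = (\<lambda>x. \<psi> x * f (\<phi> x))"

definition comp_op :: "(real \<Rightarrow> real) \<Rightarrow> real operator" where
  "comp_op \<phi> = weighted_comp (\<lambda>x. 1) \<phi>"

definition small_decay :: "(real \<Rightarrow> real) \<Rightarrow> (real \<Rightarrow> complex) \<Rightarrow> bool" where
  "small_decay \<phi> \<psi> \<longleftrightarrow> smooth \<psi> \<and>
     (\<exists>m>0. (INF x\<in>{x. m \<le> \<bar>x\<bar>}. (1 + \<bar>x\<bar>) powr m * (1 + \<bar>\<phi> x\<bar>) powr m * norm (\<psi> x)) > 0)"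

text \<open>
  Small decay is only a lower bound on \<open>\<psi>\<close>, which may grow so fast that \<open>weighted_comp \<psi> \<phi>\<close> does
  not map the Schwartz space into itself. Quantification over the symbols of small decay
  is therefore over those for which it is an operator on the Schwartz space.
\<close>

definition small_decay_symbols :: "(real \<Rightarrow> real) \<Rightarrow> (real \<Rightarrow> complex) set" where
  "small_decay_symbols \<phi> =
     {\<psi>. small_decay \<phi> \<psi> \<and> weighted_comp \<psi> \<phi> \<in> operators schwartz schwartz_seminorms}"

end

theory Submission
  imports Defs
begin

text \<open>
  Write \<open>T = C\<^bsub>\<psi>,\<phi>\<^esub>\<close>, \<open>\<phi>\<^sub>n\<close> for the \<open>n\<close>-th iterate of \<open>\<phi>\<close> and \<open>u\<^sub>n = 1 + \<bar>\<phi>\<^sub>n\<bar>\<close>.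

  If \<open>\<phi>\<close> has no fixed point, its orbits are strictly monotone and cannot stay bounded, so by
  compactness a uniform number of steps brings every point into the region where \<open>\<phi>\<close> at least
  doubles absolute values. Hence \<open>u\<^sub>n \<ge> 2 ^ (n - N)\<close> uniformly on the real line, and since the degree is at
  least two, \<open>u\<^sub>n\<^sub>+\<^sub>1 \<ge> c u\<^sub>n ^ 2\<close>, so the product of \<open>u\<^sub>0, \<dots>, u\<^sub>n\<^sub>-\<^sub>1\<close> is at most \<open>u\<^sub>n / c ^ n\<close>. For a
  multiplier \<open>\<psi>\<close> the derivatives of \<open>T f\<close> up to order \<open>j\<close> at \<open>x\<close> are at most \<open>A (1 + \<bar>x\<bar>) ^ r\<close> times those of
  \<open>f\<close> at \<open>\<phi> x\<close>. Iterating this, the product of the factors \<open>A u\<^sub>i ^ r\<close> is absorbed by a power of \<open>u\<^sub>n\<close>, and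
  every seminorm of \<open>T ^ n f\<close> is at most \<open>D 2 ^ (- n)\<close> times a fixed seminorm of \<open>f\<close>. This gives all
  the convergence statements. Symbols of small decay that define operators are multipliers.

  If \<open>\<phi>\<close> has a fixed point, let \<open>b\<close> be the largest point with bounded orbit and \<open>g\<close> a Gaussian. The
  Cesaro means of \<open>g \<circ> \<phi>\<^sub>n\<close> are bounded below at \<open>b\<close> but tend to \<open>0\<close> at every \<open>x > b\<close>, so their
  first derivatives are unbounded. This contradicts each of the conditions for \<open>\<psi> = 1\<close>, which
  belongs to both classes of symbols.
\<close>

section \<open>Smooth functions and multipliers\<close>


definition deriv1 :: "(real \<Rightarrow> complex) \<Rightarrow> real \<Rightarrow> complex" where
  "deriv1 f = (\<lambda>x. vector_derivative f (at x))"

lemma nth_deriv_0 [simp]: "nth_deriv 0 f = f"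
  by (simp add: nth_deriv_def)

lemma nth_deriv_Suc: "nth_deriv (Suc n) f = deriv1 (nth_deriv n f)"
  by (simp add: nth_deriv_def deriv1_def)

text \<open>Peels off the innermost derivative instead of the outermost one. Inductions on the order
  that generalise over the function need this form.\<close>

lemma nth_deriv_Suc': "nth_deriv (Suc n) f = nth_deriv n (deriv1 f)"
  unfolding nth_deriv_def deriv1_def by (subst funpow_Suc_right) simp

lemma deriv1_eqI: "(\<And>x. (f has_vector_derivative f' x) (at x)) \<Longrightarrow> deriv1 f = f'"
  unfolding deriv1_def by (intro ext vector_derivative_at)

text \<open>Smoothness is graded by order so that closure properties admit induction: the derivative
  of a product or a composition is built from functions that are differentiable to one order
  less.\<close>

definition diff_upto :: "nat \<Rightarrow> (real \<Rightarrow> complex) \<Rightarrow> bool" where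
  "diff_upto n f \<longleftrightarrow> (\<forall>m<n. \<forall>x. nth_deriv m f differentiable (at x))"

lemma smooth_iff_diff_upto: "smooth f \<longleftrightarrow> (\<forall>n. diff_upto n f)"
  unfolding smooth_def diff_upto_def by blast

lemma diff_upto_0 [simp]: "diff_upto 0 f"
  by (simp add: diff_upto_def)

lemma diff_upto_Suc:
  "diff_upto (Suc n) f \<longleftrightarrow> (\<forall>x. f differentiable (at x)) \<and> diff_upto n (deriv1 f)"
  unfolding diff_upto_def by (auto simp: nth_deriv_Suc' less_Suc_eq_0_disj)

lemma diff_upto_SucD: "diff_upto (Suc n) f \<Longrightarrow> diff_upto n f"
  unfolding diff_upto_def by auto

lemma diff_upto_SucI:
  assumes "\<And>x. (f has_vector_derivative f' x) (at x)" "diff_upto n f'"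
  shows "diff_upto (Suc n) f"
  using assms deriv1_eqI[OF assms(1)]
  by (auto simp: diff_upto_Suc intro: differentiableI_vector)

lemma diff_upto_has_vd: "diff_upto (Suc n) f \<Longrightarrow> (f has_vector_derivative deriv1 f x) (at x)"
  by (simp add: diff_upto_Suc deriv1_def vector_derivative_works flip: vector_derivative_works)

lemma smooth_has_vd: "smooth f \<Longrightarrow> (f has_vector_derivative deriv1 f x) (at x)"
  using diff_upto_has_vd smooth_iff_diff_upto by blast

lemma smooth_deriv1: "smooth f \<Longrightarrow> smooth (deriv1 f)"
  using diff_upto_Suc smooth_iff_diff_upto by blast

lemma has_vd_lincomb:
  fixes f g :: "real \<Rightarrow> complex"
  assumes "(f has_vector_derivative f') (at x)" "(g has_vector_derivative g') (at x)"
  shows "((\<lambda>x. a * f x + b * g x) has_vector_derivative (a * f' + b * g')) (at x)"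
  using assms by (auto intro!: derivative_eq_intros)

lemma diff_upto_lincomb:
  "diff_upto n f \<Longrightarrow> diff_upto n g \<Longrightarrow> diff_upto n (\<lambda>x. a * f x + b * g x)"
proof (induction n arbitrary: f g)
  case (Suc n)
  have "diff_upto n (\<lambda>x. a * deriv1 f x + b * deriv1 g x)"
    using Suc by (simp add: diff_upto_Suc)
  then show ?case
    using Suc.prems by (intro diff_upto_SucI[OF has_vd_lincomb]) (rule diff_upto_has_vd, assumption)+
qed simp

lemma smooth_lincomb: "smooth f \<Longrightarrow> smooth g \<Longrightarrow> smooth (\<lambda>x. a * f x + b * g x)"
  by (simp add: smooth_iff_diff_upto diff_upto_lincomb)

lemma deriv1_lincomb:
  "smooth f \<Longrightarrow> smooth g \<Longrightarrow> deriv1 (\<lambda>x. a * f x + b * g x) = (\<lambda>x. a * deriv1 f x + b * deriv1 g x)"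
  by (intro deriv1_eqI has_vd_lincomb smooth_has_vd)

lemma nth_deriv_lincomb:
  "smooth f \<Longrightarrow> smooth g \<Longrightarrow>
   nth_deriv n (\<lambda>x. a * f x + b * g x) = (\<lambda>x. a * nth_deriv n f x + b * nth_deriv n g x)"
  by (induction n arbitrary: f g) (simp_all add: nth_deriv_Suc' deriv1_lincomb smooth_deriv1)

lemma nth_deriv_add:
  "smooth f \<Longrightarrow> smooth g \<Longrightarrow> nth_deriv n (\<lambda>x. f x + g x) = (\<lambda>x. nth_deriv n f x + nth_deriv n g x)"
  using nth_deriv_lincomb[of f g n 1 1] by simp

lemma has_vd_mult:
  fixes f g :: "real \<Rightarrow> complex"
  assumes "(f has_vector_derivative f') (at x)" "(g has_vector_derivative g') (at x)"
  shows "((\<lambda>x. f x * g x) has_vector_derivative (f' * g x + f x * g')) (at x)"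
  using has_vector_derivative_mult[OF assms] by (simp add: add.commute)

lemma diff_upto_add: "diff_upto n f \<Longrightarrow> diff_upto n g \<Longrightarrow> diff_upto n (\<lambda>x. f x + g x)"
  using diff_upto_lincomb[of n f g 1 1] by simp

lemma diff_upto_mult: "diff_upto n f \<Longrightarrow> diff_upto n g \<Longrightarrow> diff_upto n (\<lambda>x. f x * g x)"
proof (induction n arbitrary: f g)
  case (Suc n)
  \<comment> \<open>Both products pair a derivative, known to order \<open>n\<close>, with an
    original factor, lowered from order \<open>Suc n\<close> to \<open>n\<close>.\<close>
  have "diff_upto n (\<lambda>x. deriv1 f x * g x + f x * deriv1 g x)"
    using Suc.prems[THEN diff_upto_SucD] Suc.prems
    by (intro diff_upto_add Suc.IH) (simp_all add: diff_upto_Suc)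
  then show ?case
    using Suc.prems by (intro diff_upto_SucI[OF has_vd_mult]) (rule diff_upto_has_vd, assumption)+
qed simp

lemma smooth_mult: "smooth f \<Longrightarrow> smooth g \<Longrightarrow> smooth (\<lambda>x. f x * g x)"
  by (simp add: smooth_iff_diff_upto diff_upto_mult)

lemma deriv1_mult:
  "smooth f \<Longrightarrow> smooth g \<Longrightarrow> deriv1 (\<lambda>x. f x * g x) = (\<lambda>x. deriv1 f x * g x + f x * deriv1 g x)"
  by (intro deriv1_eqI has_vd_mult smooth_has_vd)

lemma has_vd_poly: "((\<lambda>x. complex_of_real (poly p x)) has_vector_derivative of_real (poly (pderiv p) x)) (at x)"
  by (intro has_vector_derivative_of_real poly_DERIV)

lemma deriv1_poly: "deriv1 (\<lambda>x. of_real (poly p x)) = (\<lambda>x. of_real (poly (pderiv p) x))"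
  by (intro deriv1_eqI has_vd_poly)

lemma diff_upto_poly: "diff_upto n (\<lambda>x. of_real (poly p x))"
  by (induction n arbitrary: p) (auto intro: diff_upto_SucI has_vd_poly)

lemma smooth_poly: "smooth (\<lambda>x. of_real (poly p x))"
  by (simp add: smooth_iff_diff_upto diff_upto_poly)

lemma has_vd_comp_poly:
  assumes "(f has_vector_derivative f') (at (poly p x))"
  shows "((\<lambda>x. f (poly p x)) has_vector_derivative of_real (poly (pderiv p) x) * f') (at x)"
proof -
  have "(poly p has_vector_derivative poly (pderiv p) x) (at x)"
    using poly_DERIV has_real_derivative_iff_has_vector_derivative by blast
  from vector_diff_chain_at[OF this assms] show ?thesis
    by (simp add: o_def scaleR_conv_of_real)
qed

lemma diff_upto_comp_poly: "diff_upto n f \<Longrightarrow> diff_upto n (\<lambda>x. f (poly p x))"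
proof (induction n arbitrary: f)
  case (Suc n)
  have "diff_upto n (\<lambda>x. of_real (poly (pderiv p) x) * deriv1 f (poly p x))"
    using Suc by (intro diff_upto_mult diff_upto_poly) (simp add: diff_upto_Suc)
  then show ?case
    using Suc.prems by (intro diff_upto_SucI[OF has_vd_comp_poly]) (rule diff_upto_has_vd, assumption)+
qed simp

lemma smooth_comp_poly: "smooth f \<Longrightarrow> smooth (\<lambda>x. f (poly p x))"
  by (simp add: smooth_iff_diff_upto diff_upto_comp_poly)

lemma smooth_weighted_comp: "smooth \<psi> \<Longrightarrow> smooth f \<Longrightarrow> smooth (weighted_comp \<psi> (poly p) f)"
  unfolding weighted_comp_def by (intro smooth_mult smooth_comp_poly)

text \<open>Leibniz and chain rule, arranged so that the result is again a sum of weighted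
  compositions, with symbols \<psi>' and \<phi>' \<psi>. Inductions on the order of differentiation
  can therefore generalise over the symbol.\<close>

lemma deriv1_weighted_comp:
  assumes "smooth \<psi>" "smooth f"
  shows "deriv1 (weighted_comp \<psi> (poly p) f) =
    (\<lambda>x. weighted_comp (deriv1 \<psi>) (poly p) f x +
         weighted_comp (\<lambda>x. of_real (poly (pderiv p) x) * \<psi> x) (poly p) (deriv1 f) x)"
proof (rule deriv1_eqI)
  fix x
  have "((\<lambda>x. \<psi> x * f (poly p x)) has_vector_derivative
      (deriv1 \<psi> x * f (poly p x) + \<psi> x * (of_real (poly (pderiv p) x) * deriv1 f (poly p x)))) (at x)"
    using assms by (intro has_vd_mult has_vd_comp_poly smooth_has_vd)
  then show "(weighted_comp \<psi> (poly p) f has_vector_derivative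
      weighted_comp (deriv1 \<psi>) (poly p) f x +
      weighted_comp (\<lambda>x. of_real (poly (pderiv p) x) * \<psi> x) (poly p) (deriv1 f) x) (at x)"
    by (simp add: weighted_comp_def mult_ac)
qed

section \<open>Polynomial bounds and multipliers\<close>

definition poly_bounded :: "(real \<Rightarrow> complex) \<Rightarrow> bool" where
  "poly_bounded g \<longleftrightarrow> (\<exists>A\<ge>0. \<exists>r. \<forall>x. norm (g x) \<le> A * (1 + \<bar>x\<bar>) ^ r)"

lemma poly_bounded_add: "poly_bounded f \<Longrightarrow> poly_bounded g \<Longrightarrow> poly_bounded (\<lambda>x. f x + g x)"
proof -
  assume "poly_bounded f" "poly_bounded g"
  then obtain A r B s where *: "0 \<le> A" "0 \<le> B" "\<And>x. norm (f x) \<le> A * (1 + \<bar>x\<bar>) ^ r"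
      "\<And>x. norm (g x) \<le> B * (1 + \<bar>x\<bar>) ^ s"
    unfolding poly_bounded_def by metis
  have "norm (f x + g x) \<le> (A + B) * (1 + \<bar>x\<bar>) ^ (r + s)" for x
  proof -
    have "norm (f x + g x) \<le> A * (1 + \<bar>x\<bar>) ^ r + B * (1 + \<bar>x\<bar>) ^ s"
      using norm_triangle_mono[OF *(3,4)] .
    also have "\<dots> \<le> A * (1 + \<bar>x\<bar>) ^ (r + s) + B * (1 + \<bar>x\<bar>) ^ (r + s)"
      using * by (intro add_mono mult_left_mono power_increasing) auto
    finally show ?thesis by (simp add: algebra_simps)
  qed
  then show ?thesis using * unfolding poly_bounded_def
    by (intro exI[of _ "A + B"] conjI exI[of _ "r + s"]) auto
qed

lemma poly_bounded_mult: "poly_bounded f \<Longrightarrow> poly_bounded g \<Longrightarrow> poly_bounded (\<lambda>x. f x * g x)"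
proof -
  assume "poly_bounded f" "poly_bounded g"
  then obtain A r B s where *: "0 \<le> A" "0 \<le> B" "\<And>x. norm (f x) \<le> A * (1 + \<bar>x\<bar>) ^ r"
      "\<And>x. norm (g x) \<le> B * (1 + \<bar>x\<bar>) ^ s"
    unfolding poly_bounded_def by metis
  have "norm (f x * g x) \<le> (A * B) * (1 + \<bar>x\<bar>) ^ (r + s)" for x
    using mult_mono[OF *(3,4), of x x] * by (simp add: norm_mult power_add mult_ac)
  then show ?thesis using * unfolding poly_bounded_def
    by (intro exI[of _ "A * B"] conjI exI[of _ "r + s"]) auto
qed

lemma poly_bounded_poly: "poly_bounded (\<lambda>x. of_real (poly p x))"
proof (induction p)
  case 0
  show ?case unfolding poly_bounded_def by (intro exI[of _ 0]) auto
next
  case (pCons a p)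
  have "poly_bounded (\<lambda>x. of_real a)"
    unfolding poly_bounded_def by (intro exI[of _ "\<bar>a\<bar>"] conjI exI[of _ 0]) auto
  moreover have "poly_bounded (\<lambda>x. of_real x)"
    unfolding poly_bounded_def by (intro exI[of _ 1] conjI exI[of _ 1]) auto
  ultimately show ?case
    using poly_bounded_add[OF _ poly_bounded_mult[OF _ pCons(2)]] by simp
qed

text \<open>For a fixed function, real exponents and natural exponents give the same notion of
  polynomial growth. Natural powers are the more convenient ones in products and iterations.\<close>

lemma multipliers_iff:
  "\<psi> \<in> multipliers \<longleftrightarrow> smooth \<psi> \<and> (\<forall>j. poly_bounded (nth_deriv j \<psi>))"
proof -
  have "(\<exists>r>0. bdd_above (range (\<lambda>x. (1 + \<bar>x\<bar>) powr (- r) * norm (g x)))) \<longleftrightarrow> poly_bounded g"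
    for g :: "real \<Rightarrow> complex"
  proof
    assume "\<exists>r>0. bdd_above (range (\<lambda>x. (1 + \<bar>x\<bar>) powr (- r) * norm (g x)))"
    then obtain r M where r: "r > 0" and M: "\<And>x. (1 + \<bar>x\<bar>) powr (- r) * norm (g x) \<le> M"
      unfolding bdd_above_def by auto
    \<comment> \<open>Rounding the exponent up only enlarges the bound, because the base is at least
      1.\<close>
    define n where "n = nat \<lceil>r\<rceil>"
    have "0 \<le> M" using M[of 0] order_trans[OF _ M[of 0]] by simp
    moreover have "norm (g x) \<le> M * (1 + \<bar>x\<bar>) ^ n" for x
    proof -
      have "norm (g x) = (1 + \<bar>x\<bar>) powr r * ((1 + \<bar>x\<bar>) powr (- r) * norm (g x))"
        by (simp add: powr_minus field_simps)
      also have "\<dots> \<le> (1 + \<bar>x\<bar>) powr r * M" by (intro mult_left_mono M) simp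
      also have "(1 + \<bar>x\<bar>) powr r \<le> (1 + \<bar>x\<bar>) powr (real n)"
        unfolding n_def by (intro powr_mono) linarith+
      finally show ?thesis using \<open>0 \<le> M\<close>
        by (simp add: powr_realpow mult_right_mono mult.commute)
    qed
    ultimately show "poly_bounded g" unfolding poly_bounded_def by blast
  next
    assume "poly_bounded g"
    then obtain A n where A: "0 \<le> A" "\<And>x. norm (g x) \<le> A * (1 + \<bar>x\<bar>) ^ n"
      unfolding poly_bounded_def by blast
    \<comment> \<open>The exponent \<open>Suc n\<close> instead of \<open>n\<close> is strictly
      positive even if \<open>n\<close> is 0.\<close>
    have "(1 + \<bar>x\<bar>) powr (- real (Suc n)) * norm (g x) \<le> A" for x
    proof -
      have "norm (g x) \<le> A * (1 + \<bar>x\<bar>) ^ Suc n"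
        using A power_increasing[of n "Suc n" "1 + \<bar>x\<bar>"]
        by (meson abs_ge_zero le_add_same_cancel1 le_SucI order_refl mult_left_mono order_trans)
      then show ?thesis
        by (simp add: powr_minus powr_realpow field_simps del: of_nat_Suc power_Suc)
    qed
    then show "\<exists>r>0. bdd_above (range (\<lambda>x. (1 + \<bar>x\<bar>) powr (- r) * norm (g x)))"
      by (intro exI[of _ "real (Suc n)"] conjI bdd_aboveI2[of _ _ A]) auto
  qed
  then show ?thesis unfolding multipliers_def by simp
qed

lemma multipliers_deriv1: "\<psi> \<in> multipliers \<Longrightarrow> deriv1 \<psi> \<in> multipliers"
  by (auto simp: multipliers_iff smooth_deriv1 simp flip: nth_deriv_Suc')

text \<open>Applying the product rule once and inducting with both factors arbitrary avoids the
  binomial form of the Leibniz formula.\<close>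

lemma multipliers_mult:
  assumes "f \<in> multipliers" "g \<in> multipliers"
  shows "(\<lambda>x. f x * g x) \<in> multipliers"
proof -
  have "poly_bounded (nth_deriv j (\<lambda>x. f x * g x))" for j
    using assms
  proof (induction j arbitrary: f g)
    case 0
    then show ?case using multipliers_iff[of f] multipliers_iff[of g]
      by (auto intro!: poly_bounded_mult dest: spec[of _ 0])
  next
    case (Suc j)
    then have "smooth f" "smooth g" by (auto simp: multipliers_iff)
    then have "nth_deriv (Suc j) (\<lambda>x. f x * g x) =
        (\<lambda>x. nth_deriv j (\<lambda>x. deriv1 f x * g x) x + nth_deriv j (\<lambda>x. f x * deriv1 g x) x)"
      by (simp add: nth_deriv_Suc' deriv1_mult nth_deriv_add smooth_mult smooth_deriv1)
    then show ?case using Suc by (auto intro!: poly_bounded_add multipliers_deriv1)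
  qed
  then show ?thesis using assms by (auto simp: multipliers_iff intro: smooth_mult)
qed

lemma nth_deriv_poly: "nth_deriv j (\<lambda>x. of_real (poly p x)) = (\<lambda>x. of_real (poly ((pderiv ^^ j) p) x))"
  by (induction j) (simp_all add: nth_deriv_Suc deriv1_poly)

lemma multipliers_poly: "(\<lambda>x. of_real (poly p x)) \<in> multipliers"
  by (simp add: multipliers_iff smooth_poly nth_deriv_poly poly_bounded_poly)

text \<open>Induction on the order with \<psi> arbitrary: one differentiation produces the symbols
  \<psi>' and \<phi>' \<psi>, which are multipliers again. The constants \<open>A\<close> and
  \<open>r\<close> depend neither on \<open>f\<close> nor on the point, which makes later iteration
  possible.\<close>

lemma weighted_comp_deriv_bound:
  assumes "\<psi> \<in> multipliers"
  shows "\<exists>A\<ge>0. \<exists>r. \<forall>f. smooth f \<longrightarrow> (\<forall>x. norm (nth_deriv j (weighted_comp \<psi> (poly p) f) x) \<le>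
           A * (1 + \<bar>x\<bar>) ^ r * (\<Sum>i\<le>j. norm (nth_deriv i f (poly p x))))"
  using assms
proof (induction j arbitrary: \<psi>)
  case 0
  then have "poly_bounded \<psi>" using multipliers_iff nth_deriv_0 by metis
  then obtain A r where "0 \<le> A" "\<And>x. norm (\<psi> x) \<le> A * (1 + \<bar>x\<bar>) ^ r"
    unfolding poly_bounded_def by blast
  then show ?case
    by (intro exI[of _ A] conjI exI[of _ r])
       (auto simp: weighted_comp_def norm_mult intro: mult_right_mono)
next
  case (Suc j)
  let ?S = "\<lambda>j f x. \<Sum>i\<le>j. norm (nth_deriv i f (poly p x))"
  let ?\<chi> = "\<lambda>x. of_real (poly (pderiv p) x) * \<psi> x"
  have \<chi>: "?\<chi> \<in> multipliers" by (intro multipliers_mult multipliers_poly Suc.prems)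
  have sm: "smooth \<psi>" "smooth ?\<chi>" using Suc.prems \<chi> by (auto simp: multipliers_iff)
  obtain A r where A: "0 \<le> A" "\<And>f x. smooth f \<Longrightarrow>
      norm (nth_deriv j (weighted_comp (deriv1 \<psi>) (poly p) f) x) \<le> A * (1 + \<bar>x\<bar>) ^ r * ?S j f x"
    using Suc.IH[OF multipliers_deriv1[OF Suc.prems]] by blast
  obtain B s where B: "0 \<le> B" "\<And>f x. smooth f \<Longrightarrow>
      norm (nth_deriv j (weighted_comp ?\<chi> (poly p) f) x) \<le> B * (1 + \<bar>x\<bar>) ^ s * ?S j f x"
    using Suc.IH[OF \<chi>] by blast
  have "norm (nth_deriv (Suc j) (weighted_comp \<psi> (poly p) f) x) \<le>
      (A + B) * (1 + \<bar>x\<bar>) ^ (r + s) * ?S (Suc j) f x" if f: "smooth f" for f x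
  proof -
    have "?S j f x \<le> ?S (Suc j) f x" by simp
    \<comment> \<open>The derivatives of f' up to order \<open>j\<close> are those of
      \<open>f\<close> of orders 1 to \<open>Suc j\<close>; the shifted sum splits off the term of
      order 0.\<close>
    moreover have "?S j (deriv1 f) x \<le> ?S (Suc j) f x"
      unfolding sum.atMost_Suc_shift by (simp add: nth_deriv_Suc')
    ultimately have
      "norm (nth_deriv j (weighted_comp (deriv1 \<psi>) (poly p) f) x) \<le> A * (1 + \<bar>x\<bar>) ^ (r + s) * ?S (Suc j) f x"
      "norm (nth_deriv j (weighted_comp ?\<chi> (poly p) (deriv1 f)) x) \<le> B * (1 + \<bar>x\<bar>) ^ (r + s) * ?S (Suc j) f x"
      using A(1) B(1)
      by (auto intro!: order_trans[OF A(2)[OF f]] order_trans[OF B(2)[OF smooth_deriv1[OF f]]]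
            mult_mono power_increasing sum_nonneg simp del: sum.atMost_Suc)
    moreover have "nth_deriv (Suc j) (weighted_comp \<psi> (poly p) f) =
        (\<lambda>x. nth_deriv j (weighted_comp (deriv1 \<psi>) (poly p) f) x +
             nth_deriv j (weighted_comp ?\<chi> (poly p) (deriv1 f)) x)"
      unfolding nth_deriv_Suc' deriv1_weighted_comp[OF sm(1) f]
      by (intro nth_deriv_add smooth_weighted_comp smooth_deriv1 sm f)
    ultimately show ?thesis
      using norm_triangle_ineq by (smt (verit) distrib_right)
  qed
  then show ?case using A(1) B(1)
    by (intro exI[of _ "A + B"] conjI exI[of _ "r + s"]) auto
qed


section \<open>Continuous operators on the Schwartz space\<close>

lemma schwartz_iff:
  "f \<in> schwartz \<longleftrightarrow> smooth f \<and> (\<forall>k j. \<exists>M. \<forall>x. (1 + \<bar>x\<bar>) ^ k * norm (nth_deriv j f x) \<le> M)"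
  unfolding schwartz_def bdd_above_def by auto

lemma schwartz_smooth: "f \<in> schwartz \<Longrightarrow> smooth f"
  by (simp add: schwartz_def)

text \<open>Membership supplies the upper bound without which the supremum of a set of reals is
  unspecified.\<close>

lemma schwartz_seminorm_upper:
  "f \<in> schwartz \<Longrightarrow> (1 + \<bar>x\<bar>) ^ k * norm (nth_deriv j f x) \<le> schwartz_seminorm k j f"
  unfolding schwartz_seminorm_def schwartz_def by (intro cSUP_upper) auto

lemma schwartz_seminorm_least:
  "(\<And>x. (1 + \<bar>x\<bar>) ^ k * norm (nth_deriv j f x) \<le> M) \<Longrightarrow> schwartz_seminorm k j f \<le> M"
  unfolding schwartz_seminorm_def by (intro cSUP_least) auto

lemma schwartz_seminorm_nonneg: "f \<in> schwartz \<Longrightarrow> 0 \<le> schwartz_seminorm k j f"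
  by (rule order_trans[OF _ schwartz_seminorm_upper[of f 0]]) auto

lemma schwartz_seminorm_mono:
  assumes "f \<in> schwartz" "k \<le> k'"
  shows "schwartz_seminorm k j f \<le> schwartz_seminorm k' j f"
proof (rule schwartz_seminorm_least)
  fix x
  have "(1 + \<bar>x\<bar>) ^ k * norm (nth_deriv j f x) \<le> (1 + \<bar>x\<bar>) ^ k' * norm (nth_deriv j f x)"
    using assms by (intro mult_right_mono power_increasing) auto
  also have "\<dots> \<le> schwartz_seminorm k' j f" by (rule schwartz_seminorm_upper[OF assms(1)])
  finally show "(1 + \<bar>x\<bar>) ^ k * norm (nth_deriv j f x) \<le> schwartz_seminorm k' j f" .
qed

lemma schwartz_lincomb_bound:
  assumes "f \<in> schwartz" "g \<in> schwartz"
  shows "(1 + \<bar>x\<bar>) ^ k * norm (nth_deriv j (\<lambda>x. a * f x + b * g x) x) \<le>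
     norm a * schwartz_seminorm k j f + norm b * schwartz_seminorm k j g"
proof -
  have "(1 + \<bar>x\<bar>) ^ k * norm (nth_deriv j (\<lambda>x. a * f x + b * g x) x) \<le>
     (1 + \<bar>x\<bar>) ^ k * (norm a * norm (nth_deriv j f x) + norm b * norm (nth_deriv j g x))"
    using assms by (intro mult_left_mono)
      (auto simp: nth_deriv_lincomb schwartz_smooth norm_mult[symmetric] intro: norm_triangle_ineq)
  also have "\<dots> = norm a * ((1 + \<bar>x\<bar>) ^ k * norm (nth_deriv j f x)) +
      norm b * ((1 + \<bar>x\<bar>) ^ k * norm (nth_deriv j g x))"
    by (simp add: algebra_simps)
  also have "\<dots> \<le> norm a * schwartz_seminorm k j f + norm b * schwartz_seminorm k j g"
    using assms by (intro add_mono mult_left_mono schwartz_seminorm_upper) auto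
  finally show ?thesis .
qed

lemma schwartz_lincomb:
  "f \<in> schwartz \<Longrightarrow> g \<in> schwartz \<Longrightarrow> (\<lambda>x. a * f x + b * g x) \<in> schwartz"
  unfolding schwartz_iff[of "\<lambda>x. a * f x + b * g x"]
  using schwartz_lincomb_bound smooth_lincomb schwartz_smooth by blast

lemma schwartz_zero: "(\<lambda>x. 0) \<in> schwartz"
proof -
  have "nth_deriv n (\<lambda>x. 0) = (\<lambda>x. 0)" for n
    using nth_deriv_poly[of n 0] by simp
  then show ?thesis using smooth_poly[of 0] by (auto simp: schwartz_iff)
qed

lemma schwartz_scale: "f \<in> schwartz \<Longrightarrow> (\<lambda>x. a * f x) \<in> schwartz"
  using schwartz_lincomb[of f f a 0] by simp

lemma schwartz_add: "f \<in> schwartz \<Longrightarrow> g \<in> schwartz \<Longrightarrow> (\<lambda>x. f x + g x) \<in> schwartz"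
  using schwartz_lincomb[of f g 1 1] by simp

lemma minus_eq_lincomb: "f - g = (\<lambda>x. 1 * f x + (-1) * (g x :: complex))"
  by (simp add: fun_eq_iff)

lemma schwartz_minus: "f \<in> schwartz \<Longrightarrow> g \<in> schwartz \<Longrightarrow> f - g \<in> schwartz"
  unfolding minus_eq_lincomb by (rule schwartz_lincomb)

text \<open>Summing over all orders up to \<open>j\<close> makes the family monotone in both indices
  on the Schwartz space. The family is thus directed, and neighbourhoods can be described by one
  norm at a time.\<close>

definition schwartz_norm :: "nat \<Rightarrow> nat \<Rightarrow> (real \<Rightarrow> complex) \<Rightarrow> real" where
  "schwartz_norm k j f = (\<Sum>i\<le>j. schwartz_seminorm k i f)"

lemma schwartz_norm_Suc: "schwartz_norm k (Suc j) f = schwartz_norm k j f + schwartz_seminorm k (Suc j) f"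
  by (simp add: schwartz_norm_def)

lemma schwartz_norm_nonneg: "f \<in> schwartz \<Longrightarrow> 0 \<le> schwartz_norm k j f"
  unfolding schwartz_norm_def by (intro sum_nonneg schwartz_seminorm_nonneg)

lemma schwartz_norm_mono:
  assumes "f \<in> schwartz" "k \<le> k'" "j \<le> j'"
  shows "schwartz_norm k j f \<le> schwartz_norm k' j' f"
proof -
  have "schwartz_norm k j f \<le> (\<Sum>i\<le>j. schwartz_seminorm k' i f)"
    unfolding schwartz_norm_def using assms by (intro sum_mono schwartz_seminorm_mono)
  also have "\<dots> \<le> schwartz_norm k' j' f"
    unfolding schwartz_norm_def using assms
    by (intro sum_mono2) (auto intro: schwartz_seminorm_nonneg)
  finally show ?thesis .
qed

lemma schwartz_seminorm_le_norm:
  "f \<in> schwartz \<Longrightarrow> i \<le> j \<Longrightarrow> schwartz_seminorm k i f \<le> schwartz_norm k j f"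
  unfolding schwartz_norm_def
  by (intro member_le_sum) (auto intro: schwartz_seminorm_nonneg)

lemma schwartz_norm_lincomb:
  assumes "f \<in> schwartz" "g \<in> schwartz"
  shows "schwartz_norm k j (\<lambda>x. a * f x + b * g x) \<le> norm a * schwartz_norm k j f + norm b * schwartz_norm k j g"
  unfolding schwartz_norm_def sum_distrib_left sum.distrib[symmetric]
  by (intro sum_mono schwartz_seminorm_least schwartz_lincomb_bound assms)

lemma schwartz_norm_scale:
  "f \<in> schwartz \<Longrightarrow> schwartz_norm k j (\<lambda>x. a * f x) \<le> norm a * schwartz_norm k j f"
  using schwartz_norm_lincomb[of f f k j a 0] by simp

lemma schwartz_norm_add:
  "f \<in> schwartz \<Longrightarrow> g \<in> schwartz \<Longrightarrow>
   schwartz_norm k j (\<lambda>x. f x + g x) \<le> schwartz_norm k j f + schwartz_norm k j g"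
  using schwartz_norm_lincomb[of f g k j 1 1] by simp

lemma schwartz_norm_zero: "schwartz_norm k j (\<lambda>x. 0) = 0"
  using schwartz_norm_scale[OF schwartz_zero, of k j 0] schwartz_norm_nonneg[OF schwartz_zero, of k j]
  by simp

lemma schwartz_norm_diff_triangle:
  assumes "f \<in> schwartz" "g \<in> schwartz" "h \<in> schwartz"
  shows "schwartz_norm k j (f - h) \<le> schwartz_norm k j (f - g) + schwartz_norm k j (g - h)"
  using schwartz_norm_add[OF schwartz_minus[OF assms(1,2)] schwartz_minus[OF assms(2,3)], of k j]
  by (simp add: fun_diff_def)

lemma finite_schwartz_seminorms_le:
  assumes "finite F" "F \<subseteq> schwartz_seminorms"
  shows "\<exists>k j. \<forall>q\<in>F. \<forall>f\<in>schwartz. q f \<le> schwartz_norm k j f"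
  using assms
proof (induction F)
  case (insert q F)
  then obtain k j where kj: "\<forall>q\<in>F. \<forall>f\<in>schwartz. q f \<le> schwartz_norm k j f" by auto
  obtain k' j' where q: "q = schwartz_seminorm k' j'"
    using insert.prems by (auto simp: schwartz_seminorms_def)
  \<comment> \<open>The maxima of the two pairs of indices dominate both the norm found for
    \<open>F\<close> and the new seminorm.\<close>
  have le: "schwartz_norm k j f \<le> schwartz_norm (max k k') (max j j') f"
    "q f \<le> schwartz_norm (max k k') (max j j') f" if "f \<in> schwartz" for f
    using that schwartz_seminorm_le_norm[OF that order_refl, of k' j']
      schwartz_norm_mono[OF that, of k' "max k k'" j' "max j j'"]
    unfolding q by (auto intro: schwartz_norm_mono)
  have "r f \<le> schwartz_norm (max k k') (max j j') f" if "r \<in> insert q F" "f \<in> schwartz" for r f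
  proof (cases "r = q")
    case False
    then have "r f \<le> schwartz_norm k j f" using kj that by simp
    also note le(1)[OF that(2)]
    finally show ?thesis .
  qed (simp add: le(2) that(2))
  then show ?case by blast
qed simp

section \<open>The topology described by balls of single norms\<close>

abbreviation "schwartz_topology \<equiv> seminorm_topology schwartz schwartz_seminorms"

lemma openin_schwartz_iff:
  "openin schwartz_topology U \<longleftrightarrow> U \<subseteq> schwartz \<and>
    (\<forall>f\<in>U. \<exists>k j e. 0 < e \<and> {g \<in> schwartz. schwartz_norm k j (g - f) < e} \<subseteq> U)"
  unfolding openin_seminorm_topology seminorm_open_def
proof (intro conj_cong ball_cong refl iffI)
  fix f assume U: "U \<subseteq> schwartz" and f: "f \<in> U"
  assume "\<exists>F e. finite F \<and> F \<subseteq> schwartz_seminorms \<and> 0 < e \<and> {g \<in> schwartz. \<forall>q\<in>F. q (g - f) < e} \<subseteq> U"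
  then obtain F e where F: "finite F" "F \<subseteq> schwartz_seminorms" "0 < e"
      "{g \<in> schwartz. \<forall>q\<in>F. q (g - f) < e} \<subseteq> U"
    by blast
  obtain k j where "\<forall>q\<in>F. \<forall>f\<in>schwartz. q f \<le> schwartz_norm k j f"
    using finite_schwartz_seminorms_le[OF F(1,2)] by blast
  then have "q (g - f) < e" if "q \<in> F" "g \<in> schwartz" "schwartz_norm k j (g - f) < e" for q g
    using that U f schwartz_minus[of g f] le_less_trans by blast
  then have "{g \<in> schwartz. schwartz_norm k j (g - f) < e} \<subseteq> {g \<in> schwartz. \<forall>q\<in>F. q (g - f) < e}"
    by blast
  then show "\<exists>k j e. 0 < e \<and> {g \<in> schwartz. schwartz_norm k j (g - f) < e} \<subseteq> U"
    using F(3,4) by (meson subset_trans)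
next
  fix f assume U: "U \<subseteq> schwartz" and f: "f \<in> U"
  assume "\<exists>k j e. 0 < e \<and> {g \<in> schwartz. schwartz_norm k j (g - f) < e} \<subseteq> U"
  then obtain k j e where e: "0 < e" "{g \<in> schwartz. schwartz_norm k j (g - f) < e} \<subseteq> U" by blast
  let ?F = "schwartz_seminorm k ` {..j}"
  \<comment> \<open>The norm has \<open>Suc j\<close> summands, so each seminorm receives an equal
    share of the radius.\<close>
  have "schwartz_norm k j (g - f) < e" if "\<forall>q\<in>?F. q (g - f) < e / real (Suc j)" for g
  proof -
    have "schwartz_norm k j (g - f) < (\<Sum>i\<le>j. e / real (Suc j))"
      unfolding schwartz_norm_def using that by (intro sum_strict_mono) auto
    then show ?thesis by simp
  qed
  then have "{g \<in> schwartz. \<forall>q\<in>?F. q (g - f) < e / real (Suc j)} \<subseteq> U"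
    using e(2) by blast
  then show "\<exists>F e. finite F \<and> F \<subseteq> schwartz_seminorms \<and> 0 < e \<and> {g \<in> schwartz. \<forall>q\<in>F. q (g - f) < e} \<subseteq> U"
    using e(1) by (intro exI[of _ ?F] exI[of _ "e / real (Suc j)"]) (auto simp: schwartz_seminorms_def)
qed

lemma openin_schwartz_ball:
  assumes "f \<in> schwartz"
  shows "openin schwartz_topology {g \<in> schwartz. schwartz_norm k j (g - f) < e}"
  unfolding openin_schwartz_iff
proof (intro conjI ballI)
  fix g assume g: "g \<in> {g \<in> schwartz. schwartz_norm k j (g - f) < e}"
  have "schwartz_norm k j (h - f) < e" if "h \<in> schwartz" "schwartz_norm k j (h - g) < e - schwartz_norm k j (g - f)" for h
    using schwartz_norm_diff_triangle[of h g f k j] that g assms by simp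
  then show "\<exists>k' j' e'. 0 < e' \<and> {h \<in> schwartz. schwartz_norm k' j' (h - g) < e'}
      \<subseteq> {g \<in> schwartz. schwartz_norm k j (g - f) < e}"
    using g by (intro exI[of _ k] exI[of _ j] exI[of _ "e - schwartz_norm k j (g - f)"]) auto
qed auto

lemma openin_schwartz_ball0: "openin schwartz_topology {g \<in> schwartz. schwartz_norm k j g < e}"
  using openin_schwartz_ball[OF schwartz_zero, of k j e] by (simp add: fun_diff_def)

lemma openin_schwartz_zeroD:
  assumes "openin schwartz_topology U" "(\<lambda>x. 0) \<in> U"
  obtains k j e where "0 < e" "{g \<in> schwartz. schwartz_norm k j g < e} \<subseteq> U"
proof -
  obtain k j e where "0 < e" "{g \<in> schwartz. schwartz_norm k j (g - (\<lambda>x. 0)) < e} \<subseteq> U"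
    using assms unfolding openin_schwartz_iff by meson
  then show thesis using that by (simp add: fun_diff_def)
qed

section \<open>Linear maps, and continuity as a family of norm estimates\<close>

definition schwartz_linear :: "real operator \<Rightarrow> bool" where
  "schwartz_linear T \<longleftrightarrow> T ` schwartz \<subseteq> schwartz \<and>
     (\<forall>f\<in>schwartz. \<forall>g\<in>schwartz. \<forall>a b. T (\<lambda>x. a * f x + b * g x) = (\<lambda>x. a * T f x + b * T g x))"

lemma schwartz_linear_lincomb:
  assumes "schwartz_linear T" "f \<in> schwartz" "g \<in> schwartz"
  shows "T (\<lambda>x. a * f x + b * g x) = (\<lambda>x. a * T f x + b * T g x)"
  by (rule assms(1)[unfolded schwartz_linear_def, THEN conjunct2, THEN bspec, THEN bspec,
        THEN spec, THEN spec, OF assms(2,3)])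

lemma schwartz_linear_scale:
  "schwartz_linear T \<Longrightarrow> f \<in> schwartz \<Longrightarrow> T (\<lambda>x. a * f x) = (\<lambda>x. a * T f x)"
  using schwartz_linear_lincomb[of T f f a 0] by simp

lemma schwartz_linear_minus:
  "schwartz_linear T \<Longrightarrow> f \<in> schwartz \<Longrightarrow> g \<in> schwartz \<Longrightarrow> T (f - g) = T f - T g"
  unfolding minus_eq_lincomb by (rule schwartz_linear_lincomb)

lemma schwartz_linear_in: "schwartz_linear T \<Longrightarrow> f \<in> schwartz \<Longrightarrow> T f \<in> schwartz"
  unfolding schwartz_linear_def by blast

lemma schwartz_linear_zero: "schwartz_linear T \<Longrightarrow> T (\<lambda>x. 0) = (\<lambda>x. 0)"
  using schwartz_linear_scale[OF _ schwartz_zero, of T 0] by simp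

text \<open>Homogeneity turns an implication between balls into a global estimate. For a family of
  maps with a common \<open>e\<close> the constant is common as well, which is how equicontinuity is
  exploited later.\<close>

lemma schwartz_linear_estimate:
  assumes T: "schwartz_linear T" and "0 < e"
    and ball: "\<And>f. f \<in> schwartz \<Longrightarrow> schwartz_norm k' j' f < e \<Longrightarrow> schwartz_norm k j (T f) < 1"
    and f: "f \<in> schwartz"
  shows "schwartz_norm k j (T f) \<le> 1 / e * schwartz_norm k' j' f"
proof (rule dense_ge)
  \<comment> \<open>Scaling by 1/z for every z above the claimed bound, instead of by the norm
    itself, treats a vanishing norm without a separate case.\<close>
  fix z assume z: "1 / e * schwartz_norm k' j' f < z"
  moreover have "0 \<le> 1 / e * schwartz_norm k' j' f"
    using f \<open>0 < e\<close> by (simp add: schwartz_norm_nonneg)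
  ultimately have "0 < z" by simp
  let ?g = "\<lambda>x. complex_of_real (1 / z) * f x"
  have g: "?g \<in> schwartz" by (intro schwartz_scale f)
  have "schwartz_norm k' j' ?g \<le> 1 / z * schwartz_norm k' j' f"
    using schwartz_norm_scale[OF f, of k' j' "complex_of_real (1 / z)"] \<open>0 < z\<close>
    by (simp add: norm_divide)
  also have "\<dots> < e" using z \<open>0 < z\<close> \<open>0 < e\<close> by (simp add: field_simps)
  finally have "schwartz_norm k j (T ?g) < 1" using ball[OF g] by simp
  moreover have "schwartz_norm k j (T f) \<le> z * schwartz_norm k j (T ?g)"
    using schwartz_norm_scale[OF schwartz_linear_in[OF T g], of k j "complex_of_real z"]
      schwartz_linear_scale[OF T f, of "complex_of_real (1 / z)"] \<open>0 < z\<close>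
    by simp
  moreover from calculation have "z * schwartz_norm k j (T ?g) \<le> z * 1"
    using \<open>0 < z\<close> by (intro mult_left_mono) auto
  ultimately show "schwartz_norm k j (T f) \<le> z" by linarith
qed

abbreviation "schwartz_operators \<equiv> operators schwartz schwartz_seminorms"

text \<open>Continuity at the origin gives an estimate through the preimage of a unit ball;
  conversely, the estimate applied to differences gives continuity at every point.\<close>

lemma operators_iff:
  "T \<in> schwartz_operators \<longleftrightarrow> schwartz_linear T \<and>
     (\<forall>k j. \<exists>C\<ge>0. \<exists>k' j'. \<forall>f\<in>schwartz. schwartz_norm k j (T f) \<le> C * schwartz_norm k' j' f)"
  (is "_ \<longleftrightarrow> _ \<and> ?est")
proof
  assume T: "T \<in> schwartz_operators"
  then have lin: "schwartz_linear T" unfolding operators_def schwartz_linear_def by simp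
  have ?est
  proof (intro allI)
    fix k j
    let ?V = "{g \<in> schwartz. schwartz_norm k j g < 1}"
    have "openin schwartz_topology {f \<in> schwartz. T f \<in> ?V}"
    proof -
      have "continuous_map schwartz_topology schwartz_topology T"
        using T by (simp add: operators_def)
      from openin_continuous_map_preimage[OF this openin_schwartz_ball0[of k j 1]] show ?thesis
        by simp
    qed
    moreover have "(\<lambda>x. 0) \<in> {f \<in> schwartz. T f \<in> ?V}"
      by (simp add: schwartz_zero schwartz_linear_zero[OF lin] schwartz_norm_zero)
    ultimately obtain k' j' e where "0 < e" "{g \<in> schwartz. schwartz_norm k' j' g < e} \<subseteq> {f \<in> schwartz. T f \<in> ?V}"
      by (rule openin_schwartz_zeroD)
    then have "\<forall>f\<in>schwartz. schwartz_norm k j (T f) \<le> 1 / e * schwartz_norm k' j' f"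
      by (intro ballI schwartz_linear_estimate[OF lin]) auto
    then show "\<exists>C\<ge>0. \<exists>k' j'. \<forall>f\<in>schwartz. schwartz_norm k j (T f) \<le> C * schwartz_norm k' j' f"
      using \<open>0 < e\<close> by (intro exI[of _ "1 / e"]) auto
  qed
  with lin show "schwartz_linear T \<and> ?est" ..
next
  assume "schwartz_linear T \<and> ?est"
  then have lin: "schwartz_linear T" and est: ?est by auto
  have "openin schwartz_topology {f \<in> schwartz. T f \<in> U}" if U: "openin schwartz_topology U" for U
    unfolding openin_schwartz_iff
  proof (intro conjI ballI)
    fix f assume f: "f \<in> {f \<in> schwartz. T f \<in> U}"
    then obtain k j e where e: "0 < e" "{g \<in> schwartz. schwartz_norm k j (g - T f) < e} \<subseteq> U"
      using U unfolding openin_schwartz_iff by blast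
    obtain C k' j' where C: "0 \<le> C" "\<forall>f\<in>schwartz. schwartz_norm k j (T f) \<le> C * schwartz_norm k' j' f"
      using est by meson
    \<comment> \<open>The denominator \<open>C + 1\<close> keeps the radius meaningful when
      \<open>C\<close> is 0.\<close>
    have "T g \<in> U" if g: "g \<in> schwartz" "schwartz_norm k' j' (g - f) < e / (C + 1)" for g
    proof -
      have gf: "g - f \<in> schwartz" using g f by (simp add: schwartz_minus)
      have "schwartz_norm k j (T g - T f) \<le> C * schwartz_norm k' j' (g - f)"
        using C(2) gf g f schwartz_linear_minus[OF lin, of g f] by auto
      also have "\<dots> \<le> (C + 1) * schwartz_norm k' j' (g - f)"
        using schwartz_norm_nonneg[OF gf] by (intro mult_right_mono) auto
      also have "\<dots> < e" using g(2) C(1) by (simp add: field_simps)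
      finally show ?thesis using e(2) schwartz_linear_in[OF lin g(1)] by blast
    qed
    then show "\<exists>k' j' e'. 0 < e' \<and> {g \<in> schwartz. schwartz_norm k' j' (g - f) < e'} \<subseteq> {f \<in> schwartz. T f \<in> U}"
      using e(1) C(1) by (intro exI[of _ k'] exI[of _ j'] exI[of _ "e / (C + 1)"]) auto
  qed auto
  then show "T \<in> schwartz_operators"
  proof -
    have "continuous_map schwartz_topology schwartz_topology T"
      unfolding continuous_map_def topspace_seminorm_topology
    proof (intro conjI allI impI)
      show "T \<in> schwartz \<rightarrow> schwartz" using schwartz_linear_in[OF lin] by (rule funcsetI)
    qed fact
    then show ?thesis
      using lin unfolding operators_def schwartz_linear_def mem_Collect_eq by (elim conjE) (intro conjI)
  qed
qed

lemma operators_linear: "T \<in> schwartz_operators \<Longrightarrow> schwartz_linear T"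
  by (simp add: operators_iff)

lemma operators_estimate:
  assumes "T \<in> schwartz_operators"
  obtains C k' j' where "0 \<le> C" "\<forall>f\<in>schwartz. schwartz_norm k j (T f) \<le> C * schwartz_norm k' j' f"
proof -
  obtain C k' j' where "0 \<le> C" "\<forall>f\<in>schwartz. schwartz_norm k j (T f) \<le> C * schwartz_norm k' j' f"
    using assms[unfolded operators_iff, THEN conjunct2, rule_format, of k j] by blast
  then show thesis by (rule that)
qed

section \<open>Constructing continuous operators\<close>

lemma schwartz_linearI:
  assumes "\<And>f. f \<in> schwartz \<Longrightarrow> T f \<in> schwartz"
    and "\<And>f g a b. f \<in> schwartz \<Longrightarrow> g \<in> schwartz \<Longrightarrow>
      T (\<lambda>x. a * f x + b * g x) = (\<lambda>x. a * T f x + b * T g x)"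
  shows "schwartz_linear T"
  unfolding schwartz_linear_def
proof (intro conjI ballI allI image_subsetI)
qed (rule assms; assumption)+

text \<open>Only single seminorms have to be estimated, with a constant of any sign. The estimates
  for the norms are assembled by induction on the order.\<close>

lemma operatorsI:
  assumes "schwartz_linear T"
    and "\<And>k j. \<exists>C k' j'. \<forall>f\<in>schwartz. schwartz_seminorm k j (T f) \<le> C * schwartz_norm k' j' f"
  shows "T \<in> schwartz_operators"
  unfolding operators_iff
proof (intro conjI allI assms(1))
  fix k j
  \<comment> \<open>Replacing \<open>c\<close> by its absolute value makes the bound monotone in the
    indices, so that two estimates can be brought to a common norm.\<close>
  have mono: "c * schwartz_norm k1 j1 f \<le> \<bar>c\<bar> * schwartz_norm k2 j2 f"
    if "f \<in> schwartz" "k1 \<le> k2" "j1 \<le> j2" for c k1 j1 f k2 j2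
    using that by (intro mult_mono schwartz_norm_mono schwartz_norm_nonneg) auto
  show "\<exists>C\<ge>0. \<exists>k' j'. \<forall>f\<in>schwartz. schwartz_norm k j (T f) \<le> C * schwartz_norm k' j' f"
  proof (induction j)
    case 0
    obtain C k' j' where "\<forall>f\<in>schwartz. schwartz_seminorm k 0 (T f) \<le> C * schwartz_norm k' j' f"
      using assms(2) by blast
    then show ?case
      using mono[of _ k' k' j' j' C]
      by (intro exI[of _ "\<bar>C\<bar>"] conjI exI[of _ k'] exI[of _ j']) (force simp: schwartz_norm_def)+
  next
    case (Suc j)
    then obtain A k1 j1 where A: "\<forall>f\<in>schwartz. schwartz_norm k j (T f) \<le> A * schwartz_norm k1 j1 f"
      by blast
    obtain B k2 j2 where B: "\<forall>f\<in>schwartz. schwartz_seminorm k (Suc j) (T f) \<le> B * schwartz_norm k2 j2 f"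
      using assms(2) by blast
    have "schwartz_norm k (Suc j) (T f) \<le> (\<bar>A\<bar> + \<bar>B\<bar>) * schwartz_norm (max k1 k2) (max j1 j2) f"
      if f: "f \<in> schwartz" for f
    proof -
      have "schwartz_norm k (Suc j) (T f) \<le> A * schwartz_norm k1 j1 f + B * schwartz_norm k2 j2 f"
        using A B f by (auto simp: schwartz_norm_Suc intro: add_mono)
      also have "\<dots> \<le> \<bar>A\<bar> * schwartz_norm (max k1 k2) (max j1 j2) f + \<bar>B\<bar> * schwartz_norm (max k1 k2) (max j1 j2) f"
        using f by (intro add_mono mono) auto
      finally show ?thesis by (simp add: algebra_simps)
    qed
    then show ?case by (intro exI[of _ "\<bar>A\<bar> + \<bar>B\<bar>"]) auto
  qed
qed

lemma operators_compose:
  assumes S: "S \<in> schwartz_operators" and T: "T \<in> schwartz_operators"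
  shows "S \<circ> T \<in> schwartz_operators"
  unfolding operators_iff
proof (intro conjI allI)
  note lin = operators_linear[OF S] operators_linear[OF T]
  show "schwartz_linear (S \<circ> T)"
    by (intro schwartz_linearI)
       (simp_all add: schwartz_linear_in[OF lin(1)] schwartz_linear_in[OF lin(2)]
         schwartz_linear_lincomb[OF lin(1)] schwartz_linear_lincomb[OF lin(2)])
  fix k j
  obtain A k1 j1 where A: "0 \<le> A" "\<forall>f\<in>schwartz. schwartz_norm k j (S f) \<le> A * schwartz_norm k1 j1 f"
    by (rule operators_estimate[OF S, where k = k and j = j])
  obtain B k2 j2 where B: "0 \<le> B" "\<forall>f\<in>schwartz. schwartz_norm k1 j1 (T f) \<le> B * schwartz_norm k2 j2 f"
    by (rule operators_estimate[OF T, where k = k1 and j = j1])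
  have "schwartz_norm k j ((S \<circ> T) f) \<le> A * B * schwartz_norm k2 j2 f" if "f \<in> schwartz" for f
    using order_trans[OF bspec[OF A(2)] mult_left_mono[OF bspec[OF B(2)] A(1)], of f] that
    by (simp add: schwartz_linear_in[OF lin(2)] mult.assoc)
  then show "\<exists>C\<ge>0. \<exists>k' j'. \<forall>f\<in>schwartz. schwartz_norm k j ((S \<circ> T) f) \<le> C * schwartz_norm k' j' f"
    using A(1) B(1) by (intro exI[of _ "A * B"] conjI exI[of _ k2] exI[of _ j2]) auto
qed

text \<open>Operators are total functions of which \<open>operators\<close> sees only the values on
  the Schwartz space. Identities such as the Leibniz rule, available there by smoothness, can thus
  be used to recognise an operator.\<close>

lemma operators_cong:
  assumes "T \<in> schwartz_operators" "\<And>f. f \<in> schwartz \<Longrightarrow> S f = T f"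
  shows "S \<in> schwartz_operators"
proof -
  have "schwartz_linear S"
    using operators_linear[OF assms(1)]
    by (intro schwartz_linearI)
       (simp_all add: assms(2) schwartz_linear_in[of T] schwartz_linear_lincomb[of T] schwartz_lincomb)
  moreover have "\<exists>C\<ge>0. \<exists>k' j'. \<forall>f\<in>schwartz. schwartz_norm k j (S f) \<le> C * schwartz_norm k' j' f" for k j
    using assms(1)[unfolded operators_iff, THEN conjunct2, rule_format, of k j] assms(2) by simp
  ultimately show ?thesis unfolding operators_iff by blast
qed

lemma operators_lincomb:
  assumes S: "S \<in> schwartz_operators" and T: "T \<in> schwartz_operators"
  shows "(\<lambda>f x. a * S f x + b * T f x) \<in> schwartz_operators"
proof (rule operatorsI)
  note lin = operators_linear[OF S] operators_linear[OF T]
  show "schwartz_linear (\<lambda>f x. a * S f x + b * T f x)"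
  proof (rule schwartz_linearI)
    fix f g c d assume "f \<in> schwartz" "g \<in> schwartz"
    then show "(\<lambda>x. a * S (\<lambda>x. c * f x + d * g x) x + b * T (\<lambda>x. c * f x + d * g x) x) =
        (\<lambda>x. c * (a * S f x + b * T f x) + d * (a * S g x + b * T g x))"
      by (simp add: schwartz_linear_lincomb[OF lin(1)] schwartz_linear_lincomb[OF lin(2)] algebra_simps)
  qed (intro schwartz_lincomb schwartz_linear_in[OF lin(1)] schwartz_linear_in[OF lin(2)])
  fix k j
  obtain A k1 j1 where A: "0 \<le> A" "\<forall>f\<in>schwartz. schwartz_norm k j (S f) \<le> A * schwartz_norm k1 j1 f"
    by (rule operators_estimate[OF S, where k = k and j = j])
  obtain B k2 j2 where B: "0 \<le> B" "\<forall>f\<in>schwartz. schwartz_norm k j (T f) \<le> B * schwartz_norm k2 j2 f"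
    by (rule operators_estimate[OF T, where k = k and j = j])
  let ?q = "schwartz_norm (max k1 k2) (max j1 j2)"
  have "schwartz_seminorm k j (\<lambda>x. a * S f x + b * T f x) \<le> (norm a * A + norm b * B) * ?q f"
    if f: "f \<in> schwartz" for f
  proof -
    have in_S: "S f \<in> schwartz" "T f \<in> schwartz" using schwartz_linear_in[OF lin(1) f] schwartz_linear_in[OF lin(2) f] .
    have "schwartz_seminorm k j (\<lambda>x. a * S f x + b * T f x) \<le> schwartz_norm k j (\<lambda>x. a * S f x + b * T f x)"
      by (intro schwartz_seminorm_le_norm schwartz_lincomb in_S order_refl)
    also have "\<dots> \<le> norm a * schwartz_norm k j (S f) + norm b * schwartz_norm k j (T f)"
      by (intro schwartz_norm_lincomb in_S)
    also have "\<dots> \<le> norm a * (A * ?q f) + norm b * (B * ?q f)"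
    proof (intro add_mono mult_left_mono)
      show "schwartz_norm k j (S f) \<le> A * ?q f"
        using A f by (intro order_trans[OF bspec[OF A(2) f]] mult_left_mono schwartz_norm_mono) auto
      show "schwartz_norm k j (T f) \<le> B * ?q f"
        using B f by (intro order_trans[OF bspec[OF B(2) f]] mult_left_mono schwartz_norm_mono) auto
    qed auto
    finally show ?thesis by (simp add: algebra_simps)
  qed
  then show "\<exists>C k' j'. \<forall>f\<in>schwartz. schwartz_seminorm k j (\<lambda>x. a * S f x + b * T f x) \<le> C * schwartz_norm k' j' f"
    by blast
qed

lemma operators_deriv1: "deriv1 \<in> schwartz_operators"
proof (rule operatorsI)
  show "schwartz_linear deriv1"
  proof (rule schwartz_linearI)
    fix f :: "real \<Rightarrow> complex" assume "f \<in> schwartz"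
    then show "deriv1 f \<in> schwartz"
      unfolding schwartz_iff nth_deriv_Suc'[symmetric] by (blast intro: smooth_deriv1)
  qed (intro deriv1_lincomb schwartz_smooth)
  fix k j
  have "schwartz_seminorm k j (deriv1 f) \<le> 1 * schwartz_norm k (Suc j) f" if "f \<in> schwartz" for f
    using schwartz_seminorm_le_norm[OF that, of "Suc j" "Suc j" k]
    by (simp add: schwartz_seminorm_def flip: nth_deriv_Suc')
  then show "\<exists>C k' j'. \<forall>f\<in>schwartz. schwartz_seminorm k j (deriv1 f) \<le> C * schwartz_norm k' j' f"
    by blast
qed

lemma operators_id: "id \<in> schwartz_operators"
  unfolding operators_def by (auto intro: continuous_map_id)

lemma operators_funpow: "T \<in> schwartz_operators \<Longrightarrow> T ^^ n \<in> schwartz_operators"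
  by (induction n) (auto intro: operators_id operators_compose)

lemma operators_zero: "(\<lambda>f x. 0) \<in> schwartz_operators"
  using operators_lincomb[OF operators_id operators_id, of 0 0] by simp

lemma operators_sum:
  "finite A \<Longrightarrow> (\<And>i. i \<in> A \<Longrightarrow> T i \<in> schwartz_operators) \<Longrightarrow> (\<lambda>f x. \<Sum>i\<in>A. T i f x) \<in> schwartz_operators"
proof (induction A rule: finite_induct)
  case (insert i A)
  then show ?case
    using operators_lincomb[of "T i" "\<lambda>f x. \<Sum>i\<in>A. T i f x" 1 1] by auto
qed (simp add: operators_zero)

text \<open>Index 0 is included: the empty sum divided by zero is the zero operator.\<close>

lemma operators_cesaro_mean:
  assumes "T \<in> schwartz_operators"
  shows "cesaro_mean T n \<in> schwartz_operators"
proof -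
  have S: "(\<lambda>f x. \<Sum>m=1..n. (T ^^ m) f x) \<in> schwartz_operators"
    using assms by (intro operators_sum operators_funpow) auto
  show ?thesis
    using operators_lincomb[OF S S, of "1 / of_nat n" 0] by (simp add: cesaro_mean_def[abs_def])
qed


section \<open>Weighted composition operators and their symbols\<close>

text \<open>Near infinity \<open>poly p x / x ^ degree p\<close> is close to the leading
  coefficient, so |p(x)| dominates a multiple of x^2; on the remaining bounded interval the summand
  1 on the right suffices.\<close>

lemma poly_growth:
  fixes p :: "real poly"
  assumes "degree p \<ge> 2"
  obtains c where "0 < c" "c \<le> 1" "\<And>x. c * (1 + \<bar>x\<bar>)\<^sup>2 \<le> 1 + \<bar>poly p x\<bar>"
proof -
  let ?d = "degree p" and ?l = "\<bar>lead_coeff p\<bar> / 2"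
  have l: "0 < ?l" using assms by auto
  have "((\<lambda>x. \<bar>poly p x / x ^ ?d\<bar>) \<longlongrightarrow> \<bar>lead_coeff p\<bar>) at_infinity"
    by (intro tendsto_rabs poly_divide_tendsto_aux)
  then have "\<forall>\<^sub>F x in at_infinity. ?l < \<bar>poly p x / x ^ ?d\<bar>"
    by (rule order_tendstoD) (use l in auto)
  then obtain b where b: "\<And>x. b \<le> \<bar>x\<bar> \<Longrightarrow> ?l < \<bar>poly p x / x ^ ?d\<bar>"
    unfolding eventually_at_infinity by auto
  define M where "M = max b 1"
  \<comment> \<open>The first entry absorbs 1 + |x| \<le> 2 |x| outside the interval, the second
    makes the left side at most 1 inside it, and the third ensures c \<le> 1.\<close>
  define c where "c = min (min (?l / 4) (1 / (1 + M)\<^sup>2)) 1"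
  have "0 < c" using l by (auto simp: c_def M_def)
  moreover have "c \<le> 1" by (simp add: c_def)
  moreover have "c * (1 + \<bar>x\<bar>)\<^sup>2 \<le> 1 + \<bar>poly p x\<bar>" for x
  proof (cases "M \<le> \<bar>x\<bar>")
    case True
    then have x: "1 \<le> \<bar>x\<bar>" "b \<le> \<bar>x\<bar>" by (auto simp: M_def)
    have "c * (1 + \<bar>x\<bar>)\<^sup>2 \<le> (?l / 4) * (2 * \<bar>x\<bar>)\<^sup>2"
      using x(1) l by (intro mult_mono power_mono) (auto simp: c_def)
    also have "\<dots> = ?l * \<bar>x\<bar>\<^sup>2" by (simp add: power_mult_distrib)
    also have "\<dots> \<le> ?l * \<bar>x\<bar> ^ ?d"
      using l x(1) assms by (intro mult_left_mono power_increasing) auto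
    also have "\<dots> \<le> \<bar>poly p x\<bar>"
      using b[OF x(2)] x(1) by (simp add: abs_divide power_abs[symmetric] field_simps)
    finally show ?thesis by simp
  next
    case False
    have "c * (1 + \<bar>x\<bar>)\<^sup>2 \<le> 1 / (1 + M)\<^sup>2 * (1 + M)\<^sup>2"
      using False by (intro mult_mono power_mono) (auto simp: c_def M_def)
    also have "\<dots> = 1" using False by (simp add: M_def)
    finally show ?thesis by simp
  qed
  ultimately show thesis by (rule that)
qed

lemma schwartz_norm_upper:
  assumes "f \<in> schwartz"
  shows "(1 + \<bar>x\<bar>) ^ k * (\<Sum>i\<le>j. norm (nth_deriv i f x)) \<le> schwartz_norm k j f"
  unfolding schwartz_norm_def sum_distrib_left using assms by (intro sum_mono schwartz_seminorm_upper)

lemma weighted_comp_lincomb: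
  "weighted_comp \<psi> \<phi> (\<lambda>x. a * f x + b * g x) = (\<lambda>x. a * weighted_comp \<psi> \<phi> f x + b * weighted_comp \<psi> \<phi> g x)"
  by (simp add: weighted_comp_def algebra_simps)

text \<open>The hypothesis on \<open>C\<close> trades weights at \<open>x\<close> for weights at
  \<open>poly p x\<close>, where the derivatives of \<open>f\<close> are evaluated. In this form the
  result also covers multiplication operators, with the identity as polynomial.\<close>

lemma weighted_comp_operator:
  assumes \<psi>: "\<psi> \<in> multipliers" and C: "\<And>x. 1 + \<bar>x\<bar> \<le> C * (1 + \<bar>poly p x\<bar>)"
  shows "weighted_comp \<psi> (poly p) \<in> schwartz_operators"
proof -
  let ?T = "weighted_comp \<psi> (poly p)"
  have *: "\<exists>D m. \<forall>f\<in>schwartz. \<forall>x. (1 + \<bar>x\<bar>) ^ k * norm (nth_deriv j (?T f) x) \<le> D * schwartz_norm m j f" for k j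
  proof -
    obtain A r where A: "0 \<le> A" "\<And>f x. smooth f \<Longrightarrow>
        norm (nth_deriv j (?T f) x) \<le> A * (1 + \<bar>x\<bar>) ^ r * (\<Sum>i\<le>j. norm (nth_deriv i f (poly p x)))"
      using weighted_comp_deriv_bound[OF \<psi>] by blast
    have "(1 + \<bar>x\<bar>) ^ k * norm (nth_deriv j (?T f) x) \<le> A * C ^ (k + r) * schwartz_norm (k + r) j f"
      if f: "f \<in> schwartz" for f x
    proof -
      let ?N = "\<Sum>i\<le>j. norm (nth_deriv i f (poly p x))"
      have "(1 + \<bar>x\<bar>) ^ k * norm (nth_deriv j (?T f) x) \<le> (1 + \<bar>x\<bar>) ^ k * (A * (1 + \<bar>x\<bar>) ^ r * ?N)"
        using f by (intro mult_left_mono A(2) schwartz_smooth) auto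
      also have "\<dots> = A * ((1 + \<bar>x\<bar>) ^ (k + r) * ?N)" by (simp add: power_add)
      also have "\<dots> \<le> A * ((C * (1 + \<bar>poly p x\<bar>)) ^ (k + r) * ?N)"
        using A(1) by (intro mult_left_mono mult_right_mono power_mono C sum_nonneg) auto
      also have "\<dots> = A * C ^ (k + r) * ((1 + \<bar>poly p x\<bar>) ^ (k + r) * ?N)"
        by (simp add: power_mult_distrib)
      also have "\<dots> \<le> A * C ^ (k + r) * schwartz_norm (k + r) j f"
      proof (rule mult_left_mono[OF schwartz_norm_upper[OF f]])
        \<comment> \<open>Evaluating the hypothesis at 0 yields the sign of
          \<open>C\<close>.\<close>
        have "0 < C * (1 + \<bar>poly p 0\<bar>)" using C[of 0] by simp
        then have "0 < C" by (rule zero_less_mult_pos2) (simp add: add_pos_nonneg)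
        then show "0 \<le> A * C ^ (k + r)" using A(1) by simp
      qed
      finally show ?thesis .
    qed
    then show ?thesis by blast
  qed
  show ?thesis
  proof (rule operatorsI)
    show "schwartz_linear ?T"
    proof (rule schwartz_linearI)
      fix f :: "real \<Rightarrow> complex" assume f: "f \<in> schwartz"
      have "smooth (?T f)" using \<psi> f by (intro smooth_weighted_comp) (auto simp: multipliers_iff schwartz_smooth)
      then show "?T f \<in> schwartz" unfolding schwartz_iff using * f by blast
    qed (rule weighted_comp_lincomb)
    show "\<exists>C k' j'. \<forall>f\<in>schwartz. schwartz_seminorm k j (?T f) \<le> C * schwartz_norm k' j' f" for k j
      using *[of k j] by (blast intro: schwartz_seminorm_least)
  qed
qed

section \<open>Translated Gaussians with polynomial factors as test functions\<close>

definition poly_gauss :: "real poly \<Rightarrow> real \<Rightarrow> real \<Rightarrow> complex" where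
  "poly_gauss q y = (\<lambda>x. of_real (poly q (x - y) * exp (- (x - y)\<^sup>2)))"

text \<open>Differentiating q(t) exp(-t^2) replaces q by q' - 2 t q. The class of polynomials times
  a Gaussian is therefore closed under differentiation, which a Gaussian alone is not.\<close>

definition gauss_step :: "real poly \<Rightarrow> real poly" where
  "gauss_step q = pderiv q - [:0, 2:] * q"

lemma has_vd_poly_gauss: "(poly_gauss q y has_vector_derivative poly_gauss (gauss_step q) y x) (at x)"
proof -
  have "((\<lambda>x. poly q (x - y) * exp (- (x - y)\<^sup>2)) has_real_derivative
     poly (gauss_step q) (x - y) * exp (- (x - y)\<^sup>2)) (at x)"
    by (auto intro!: derivative_eq_intros simp: gauss_step_def power2_eq_square algebra_simps)
  from has_vector_derivative_of_real[OF this] show ?thesis by (simp add: poly_gauss_def)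
qed

lemma smooth_poly_gauss: "smooth (poly_gauss q y)"
proof -
  have "diff_upto n (poly_gauss q y)" for n
    by (induction n arbitrary: q) (auto intro: diff_upto_SucI has_vd_poly_gauss)
  then show ?thesis by (simp add: smooth_iff_diff_upto)
qed

lemma nth_deriv_poly_gauss: "nth_deriv j (poly_gauss q y) = poly_gauss ((gauss_step ^^ j) q) y"
  by (induction j) (auto simp: nth_deriv_Suc intro!: deriv1_eqI has_vd_poly_gauss)

text \<open>From 1 + |t| \<le> exp |t| and n |t| - t^2 \<le> n^2, the latter by the inequality
  between arithmetic and geometric means.\<close>

lemma power_gauss_bound: "(1 + \<bar>t\<bar>) ^ n * exp (- t\<^sup>2) \<le> exp (real n ^ 2)"
proof -
  have "(1 + \<bar>t\<bar>) ^ n * exp (- t\<^sup>2) \<le> exp \<bar>t\<bar> ^ n * exp (- t\<^sup>2)"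
    by (intro mult_right_mono power_mono exp_ge_add_one_self) auto
  also have "\<dots> = exp (real n * \<bar>t\<bar> - t\<^sup>2)"
    by (simp add: exp_of_nat_mult[symmetric] exp_add[symmetric])
  also have "real n * \<bar>t\<bar> - t\<^sup>2 \<le> real n ^ 2"
  proof -
    have "2 * (real n * \<bar>t\<bar>) \<le> (real n)\<^sup>2 + t\<^sup>2"
      using sum_squares_bound[of "real n" "\<bar>t\<bar>"] by simp
    then show ?thesis using zero_le_power2[of "real n"] zero_le_power2[of t] by linarith
  qed
  finally show ?thesis by simp
qed

text \<open>The polynomial dependence on the centre is the point: with centre
  \<open>poly p x\<close> it becomes a polynomial bound in \<open>x\<close> for the symbol.\<close>

lemma poly_gauss_bound: "\<exists>M\<ge>0. \<forall>y x. (1 + \<bar>x\<bar>) ^ k * norm (poly_gauss q y x) \<le> M * (1 + \<bar>y\<bar>) ^ k"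
proof -
  obtain A r where A: "0 \<le> A" "\<And>x. norm (complex_of_real (poly q x)) \<le> A * (1 + \<bar>x\<bar>) ^ r"
    using poly_bounded_poly[of q] unfolding poly_bounded_def by blast
  have "(1 + \<bar>x\<bar>) ^ k * norm (poly_gauss q y x) \<le> A * exp (real (k + r) ^ 2) * (1 + \<bar>y\<bar>) ^ k" for x y
  proof -
    \<comment> \<open>A Peetre-type inequality moves the weight to x - y, where the Gaussian absorbs
      it.\<close>
    have "1 + \<bar>x\<bar> \<le> (1 + \<bar>x - y\<bar>) * (1 + \<bar>y\<bar>)"
    proof -
      have "1 + \<bar>x\<bar> \<le> 1 + \<bar>x - y\<bar> + \<bar>y\<bar>" by linarith
      also have "\<dots> \<le> 1 + \<bar>x - y\<bar> + \<bar>y\<bar> + \<bar>x - y\<bar> * \<bar>y\<bar>" by simp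
      finally show ?thesis by (simp add: algebra_simps)
    qed
    then have "(1 + \<bar>x\<bar>) ^ k * norm (poly_gauss q y x) \<le>
        ((1 + \<bar>x - y\<bar>) * (1 + \<bar>y\<bar>)) ^ k * (A * (1 + \<bar>x - y\<bar>) ^ r * exp (- (x - y)\<^sup>2))"
      using A(1) A(2)[of "x - y"]
      by (intro mult_mono power_mono) (auto simp: poly_gauss_def norm_mult abs_mult)
    also have "\<dots> = A * ((1 + \<bar>x - y\<bar>) ^ (k + r) * exp (- (x - y)\<^sup>2)) * (1 + \<bar>y\<bar>) ^ k"
      by (simp add: power_mult_distrib power_add)
    also have "\<dots> \<le> A * exp (real (k + r) ^ 2) * (1 + \<bar>y\<bar>) ^ k"
      using A(1) by (intro mult_left_mono mult_right_mono power_gauss_bound) auto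
    finally show ?thesis .
  qed
  then show ?thesis using A(1) by (intro exI[of _ "A * exp (real (k + r) ^ 2)"]) auto
qed

lemma poly_gauss_schwartz: "poly_gauss q y \<in> schwartz"
  unfolding schwartz_iff nth_deriv_poly_gauss using smooth_poly_gauss poly_gauss_bound by blast

lemma schwartz_norm_poly_gauss: "\<exists>M\<ge>0. \<forall>y. schwartz_norm k j (poly_gauss q y) \<le> M * (1 + \<bar>y\<bar>) ^ k"
proof (induction j)
  case 0
  then show ?case
    using poly_gauss_bound[of k q] by (auto simp: schwartz_norm_def intro!: schwartz_seminorm_least)
next
  case (Suc j)
  then obtain M where M: "0 \<le> M" "\<And>y. schwartz_norm k j (poly_gauss q y) \<le> M * (1 + \<bar>y\<bar>) ^ k" by blast
  obtain L where L: "0 \<le> L" "\<And>y x. (1 + \<bar>x\<bar>) ^ k * norm (nth_deriv (Suc j) (poly_gauss q y) x) \<le> L * (1 + \<bar>y\<bar>) ^ k"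
    using poly_gauss_bound[of k] unfolding nth_deriv_poly_gauss by blast
  have "schwartz_norm k (Suc j) (poly_gauss q y) \<le> (M + L) * (1 + \<bar>y\<bar>) ^ k" for y
    unfolding schwartz_norm_Suc distrib_right by (intro add_mono M schwartz_seminorm_least L)
  then show ?case using M(1) L(1) by (intro exI[of _ "M + L"]) auto
qed

text \<open>
  The operator is tested on Gaussians centred at \<open>\<phi> x\<close>: they take the value 1 there, and their
  seminorms grow polynomially with the centre.
\<close>

lemma operator_symbol_poly_bounded:
  assumes "weighted_comp \<psi> (poly p) \<in> schwartz_operators"
  shows "poly_bounded \<psi>"
proof -
  let ?T = "weighted_comp \<psi> (poly p)"
  obtain C k' j' where C: "0 \<le> C" "\<forall>f\<in>schwartz. schwartz_norm 0 0 (?T f) \<le> C * schwartz_norm k' j' f"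
    by (rule operators_estimate[OF assms, where k = 0 and j = 0])
  obtain M where M: "0 \<le> M" "\<And>y. schwartz_norm k' j' (poly_gauss 1 y) \<le> M * (1 + \<bar>y\<bar>) ^ k'"
    using schwartz_norm_poly_gauss by blast
  obtain B s where B: "0 \<le> B" "\<And>x. \<bar>poly p x\<bar> \<le> B * (1 + \<bar>x\<bar>) ^ s"
    using poly_bounded_poly[of p] unfolding poly_bounded_def by auto
  have "norm (\<psi> x) \<le> C * M * (1 + B) ^ k' * (1 + \<bar>x\<bar>) ^ (s * k')" for x
  proof -
    let ?g = "poly_gauss 1 (poly p x)"
    have "norm (\<psi> x) = norm (?T ?g x)" by (simp add: weighted_comp_def poly_gauss_def)
    also have "\<dots> \<le> schwartz_norm 0 0 (?T ?g)"
      using schwartz_norm_upper[OF schwartz_linear_in[OF operators_linear[OF assms] poly_gauss_schwartz],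
          where x = x and k = 0 and j = 0]
      by simp
    also have "\<dots> \<le> C * (M * (1 + \<bar>poly p x\<bar>) ^ k')"
      using C(1) by (intro order_trans[OF bspec[OF C(2) poly_gauss_schwartz]] mult_left_mono M)
    also have "\<dots> \<le> C * (M * ((1 + B) * (1 + \<bar>x\<bar>) ^ s) ^ k')"
    proof (intro mult_left_mono power_mono)
      have "1 \<le> (1 + \<bar>x\<bar>) ^ s" by (rule one_le_power) simp
      then show "1 + \<bar>poly p x\<bar> \<le> (1 + B) * (1 + \<bar>x\<bar>) ^ s"
        unfolding distrib_right mult_1 by (rule add_mono[OF _ B(2)])
    qed (use C M in auto)
    finally show ?thesis by (simp add: power_mult_distrib power_mult mult.assoc)
  qed
  then show ?thesis unfolding poly_bounded_def using C(1) M(1) B(1)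
    by (intro exI[of _ "C * M * (1 + B) ^ k'"]) auto
qed

text \<open>By the Leibniz rule \<open>\<psi>' \<cdot> (f \<circ> \<phi>) = (\<psi> \<cdot> (f \<circ> \<phi>))' - \<phi>' \<cdot> \<psi> \<cdot> (f' \<circ> \<phi>)\<close>.\<close>

lemma deriv1_symbol_operator:
  assumes "smooth \<psi>" "weighted_comp \<psi> (poly p) \<in> schwartz_operators"
  shows "weighted_comp (deriv1 \<psi>) (poly p) \<in> schwartz_operators"
proof -
  let ?T = "weighted_comp \<psi> (poly p)"
  \<comment> \<open>Multiplication by \<phi>' is written as a weighted composition with the identity
    polynomial.\<close>
  let ?M = "weighted_comp (\<lambda>x. of_real (poly (pderiv p) x)) (poly [:0, 1:])"
  have M: "?M \<in> schwartz_operators"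
    by (rule weighted_comp_operator[OF multipliers_poly, where C = 1]) simp
  have "(\<lambda>f x. 1 * (deriv1 \<circ> ?T) f x + (- 1) * (?M \<circ> (?T \<circ> deriv1)) f x) \<in> schwartz_operators"
    by (intro operators_lincomb operators_compose operators_deriv1 M assms(2))
  then show ?thesis
  proof (rule operators_cong)
    fix f :: "real \<Rightarrow> complex" assume "f \<in> schwartz"
    then show "weighted_comp (deriv1 \<psi>) (poly p) f =
        (\<lambda>x. 1 * (deriv1 \<circ> ?T) f x + (- 1) * (?M \<circ> (?T \<circ> deriv1)) f x)"
      by (simp add: deriv1_weighted_comp[OF assms(1) schwartz_smooth]) (simp add: weighted_comp_def fun_eq_iff)
  qed
qed

text \<open>Each derivative of \<psi> is again the symbol of an operator, hence polynomially
  bounded. This reduces symbols of small decay to multipliers.\<close>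

lemma operator_symbol_multiplier:
  assumes "smooth \<psi>" "weighted_comp \<psi> (poly p) \<in> schwartz_operators"
  shows "\<psi> \<in> multipliers"
proof -
  have "poly_bounded (nth_deriv j \<psi>)" for j
    using assms
  proof (induction j arbitrary: \<psi>)
    case 0
    then show ?case by (simp add: operator_symbol_poly_bounded)
  next
    case (Suc j)
    then show ?case
      unfolding nth_deriv_Suc' by (intro Suc.IH smooth_deriv1 deriv1_symbol_operator)
  qed
  then show ?thesis using assms(1) by (simp add: multipliers_iff)
qed


section \<open>Dynamics of polynomials without fixed points\<close>

lemma poly_doubling:
  fixes p :: "real poly"
  assumes "degree p \<ge> 2"
  obtains R where "1 \<le> R" "\<And>y. R \<le> \<bar>y\<bar> \<Longrightarrow> 2 * \<bar>y\<bar> \<le> \<bar>poly p y\<bar>"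
proof -
  obtain c where c: "0 < c" "c \<le> 1" "\<And>x. c * (1 + \<bar>x\<bar>)\<^sup>2 \<le> 1 + \<bar>poly p x\<bar>"
    using poly_growth[OF assms] by metis
  \<comment> \<open>With the threshold 3/c the quadratic bound gives |p(y)| \<ge> 3 |y| - 1, and c
    \<le> 1 gives |y| \<ge> 3, so one |y| pays for the 1.\<close>
  have "2 * \<bar>y\<bar> \<le> \<bar>poly p y\<bar>" if "3 / c \<le> \<bar>y\<bar>" for y
  proof -
    have y: "3 \<le> c * \<bar>y\<bar>" using that c(1) by (simp add: field_simps)
    also have "\<dots> \<le> 1 * \<bar>y\<bar>" using c(2) by (intro mult_right_mono) auto
    finally have "3 \<le> \<bar>y\<bar>" by simp
    have "3 * \<bar>y\<bar> \<le> c * \<bar>y\<bar> * \<bar>y\<bar>" using y by (intro mult_right_mono) auto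
    also have "\<dots> \<le> c * (1 + \<bar>y\<bar>)\<^sup>2"
      using c(1) by (simp add: power2_eq_square algebra_simps)
    also note c(3)[of y]
    finally show ?thesis using \<open>3 \<le> \<bar>y\<bar>\<close> by linarith
  qed
  moreover have "1 \<le> 3 / c" using c by (simp add: field_simps)
  ultimately show thesis by (rule that[rotated])
qed

lemma iterate_growth:
  fixes \<phi> :: "real \<Rightarrow> real"
  assumes R: "0 \<le> R" "\<And>y. R \<le> \<bar>y\<bar> \<Longrightarrow> 2 * \<bar>y\<bar> \<le> \<bar>\<phi> y\<bar>" and x: "R \<le> \<bar>x\<bar>"
  shows "2 ^ n * \<bar>x\<bar> \<le> \<bar>(\<phi> ^^ n) x\<bar>"
proof (induction n)
  case (Suc n)
  have "R \<le> 1 * \<bar>x\<bar>" using x by simp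
  also have "\<dots> \<le> 2 ^ n * \<bar>x\<bar>" by (intro mult_right_mono) auto
  finally have "R \<le> \<bar>(\<phi> ^^ n) x\<bar>" using Suc by linarith
  from R(2)[OF this] show ?case using Suc by simp
qed simp

text \<open>The constant \<open>2 ^ N\<close> compensates for the steps before the orbit enters the
  doubling region. Adding 1 to the absolute value makes the bound trivial for \<open>n < m\<close>,
  where nothing is known about the orbit.\<close>

lemma orbit_growth:
  fixes \<phi> :: "real \<Rightarrow> real"
  assumes R: "1 \<le> R" "\<And>y. R \<le> \<bar>y\<bar> \<Longrightarrow> 2 * \<bar>y\<bar> \<le> \<bar>\<phi> y\<bar>"
    and m: "R \<le> \<bar>(\<phi> ^^ m) x\<bar>" "m \<le> N"
  shows "2 ^ n \<le> 2 ^ N * (1 + \<bar>(\<phi> ^^ n) x\<bar>)"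
proof (cases "m \<le> n")
  case True
  have "2 ^ (n - m) * 1 \<le> 2 ^ (n - m) * \<bar>(\<phi> ^^ m) x\<bar>" using R(1) m(1) by (intro mult_left_mono) auto
  also have "\<dots> \<le> \<bar>(\<phi> ^^ (n - m)) ((\<phi> ^^ m) x)\<bar>"
    by (rule iterate_growth[OF _ R(2) m(1)]) (use R(1) in simp)
  also have "(\<phi> ^^ (n - m)) ((\<phi> ^^ m) x) = (\<phi> ^^ n) x"
    using True by (simp flip: funpow_add comp_apply[of "\<phi> ^^ (n - m)" "\<phi> ^^ m"])
  finally have growth: "2 ^ (n - m) \<le> \<bar>(\<phi> ^^ n) x\<bar>" by simp
  have "2 ^ n = (2 :: real) ^ m * 2 ^ (n - m)" using True by (simp flip: power_add)
  also have "\<dots> \<le> 2 ^ N * (1 + \<bar>(\<phi> ^^ n) x\<bar>)"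
    using growth m(2) by (intro mult_mono power_increasing) auto
  finally show ?thesis .
next
  case False
  then have "(2 :: real) ^ n * 1 \<le> 2 ^ N * (1 + \<bar>(\<phi> ^^ n) x\<bar>)"
    using m(2) by (intro mult_mono power_increasing) auto
  then show ?thesis by simp
qed

section \<open>Orbits of polynomials without fixed points\<close>

lemma continuous_on_iterate: "continuous_on UNIV (poly (p :: real poly) ^^ n)"
proof (induction n)
  case (Suc n)
  have "continuous_on UNIV (\<lambda>x. poly p ((poly p ^^ n) x))"
    by (intro continuous_on_poly Suc)
  then show ?case by (simp add: o_def)
qed (simp add: id_def)

text \<open>Intermediate value theorem for p(x) - x. It makes all orbits monotone in the same
  direction.\<close>

lemma no_fixed_point_cases:
  fixes p :: "real poly"
  assumes "\<forall>x. poly p x \<noteq> x"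
  shows "(\<forall>x. poly p x < x) \<or> (\<forall>x. x < poly p x)"
proof (rule ccontr)
  let ?r = "p - [:0, 1:]"
  assume "\<not> ?thesis"
  then obtain a b where "poly p a > a" "poly p b < b"
    using assms by (meson linorder_neqE_linordered_idom)
  then have ab: "0 < poly ?r a" "poly ?r b < 0" by auto
  then have "a \<noteq> b" by auto
  then obtain x where "poly ?r x = 0"
    using poly_IVT_neg[of a b ?r] poly_IVT_pos[of b a ?r] ab by (metis linorder_neqE_linordered_idom)
  then show False using assms by simp
qed

lemma odd_degree_root:
  fixes r :: "real poly"
  assumes "odd (degree r)"
  shows "\<exists>x. poly r x = 0"
proof (rule ccontr)
  assume no: "\<not> ?thesis"
  let ?d = "degree r" and ?l = "lead_coeff r"
  have "?l \<noteq> 0" using assms by (cases "r = 0") auto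
  \<comment> \<open>Multiplying by the leading coefficient gives a positive limit whatever its sign;
    the odd power of \<open>x\<close> then changes sign between \<open>z\<close> and
    \<open>- z\<close>.\<close>
  have "((\<lambda>x. ?l * (poly r x / x ^ ?d)) \<longlongrightarrow> ?l * ?l) at_infinity"
    by (intro tendsto_intros poly_divide_tendsto_aux)
  then have "\<forall>\<^sub>F x in at_infinity. 0 < ?l * (poly r x / x ^ ?d)"
    by (rule order_tendstoD) (use \<open>?l \<noteq> 0\<close> not_real_square_gt_zero[of ?l] in blast)
  then obtain b where b: "\<And>x. b \<le> \<bar>x\<bar> \<Longrightarrow> 0 < ?l * (poly r x / x ^ ?d)"
    unfolding eventually_at_infinity by auto
  define z where "z = max b 1"
  have z: "0 < z" "b \<le> \<bar>z\<bar>" "b \<le> \<bar>- z\<bar>" by (auto simp: z_def)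
  have "0 < ?l * (poly r z / z ^ ?d) * z ^ ?d"
    by (rule mult_pos_pos[OF b[OF z(2)]]) (use z(1) in simp)
  then have "0 < ?l * poly r z" using z(1) by simp
  moreover have "?l * (poly r (- z) / (- z) ^ ?d) * (- z) ^ ?d < 0"
    by (rule mult_pos_neg[OF b[OF z(3)]]) (use z(1) assms in \<open>simp add: power_minus_odd\<close>)
  then have "?l * poly r (- z) < 0" using z(1) by simp
  ultimately have "0 < poly r z \<and> poly r (- z) < 0 \<or> poly r z < 0 \<and> 0 < poly r (- z)"
    by (auto simp: zero_less_mult_iff mult_less_0_iff)
  then show False using no poly_IVT_pos[of "- z" z r] poly_IVT_neg[of "- z" z r] z(1) by auto
qed

text \<open>Subtracting x does not change a degree of at least two, and for an odd degree the
  difference would have a root.\<close>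

lemma no_fixed_point_even_degree:
  fixes p :: "real poly"
  assumes "degree p \<ge> 2" "\<forall>x. poly p x \<noteq> x"
  shows "even (degree p)"
proof (rule ccontr)
  assume odd: "odd (degree p)"
  have "degree (p + - [:0, 1:]) = degree p"
    by (rule degree_add_eq_left) (use assms(1) in simp)
  then obtain x where "poly (p + - [:0, 1:]) x = 0"
    using odd_degree_root[of "p + - [:0, 1:]"] odd by auto
  then show False using assms(2) by simp
qed

text \<open>A bounded orbit would be monotone, hence convergent, and by continuity its limit would
  be a fixed point.\<close>

lemma no_fixed_point_unbounded_orbit:
  fixes p :: "real poly"
  assumes "\<forall>x. poly p x \<noteq> x"
  shows "\<exists>n. R < \<bar>(poly p ^^ n) x\<bar>"
proof (rule ccontr)
  define X where "X n = (poly p ^^ n) x" for n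
  assume "\<not> ?thesis"
  then have "\<bar>X n\<bar> \<le> R" for n by (auto simp: X_def not_less)
  then have "Bseq X" by (intro BseqI') auto
  moreover have "monoseq X"
    using no_fixed_point_cases[OF assms] by (auto simp: monoseq_Suc X_def intro: less_imp_le)
  ultimately obtain L where L: "X \<longlonglongrightarrow> L"
    using Bseq_monoseq_convergent convergent_def by blast
  then have "(\<lambda>n. poly p (X n)) \<longlonglongrightarrow> poly p L" by (intro tendsto_poly)
  moreover have "(\<lambda>n. poly p (X n)) = (\<lambda>n. X (Suc n))" by (simp add: X_def)
  ultimately have "poly p L = L" using LIMSEQ_unique LIMSEQ_Suc[OF L] by metis
  then show False using assms by blast
qed

lemma no_fixed_point_uniform_growth:
  fixes p :: "real poly"
  assumes deg: "degree p \<ge> 2" and "\<forall>x. poly p x \<noteq> x"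
  shows "\<exists>N. \<forall>n x. 2 ^ n \<le> 2 ^ N * (1 + \<bar>(poly p ^^ n) x\<bar>)"
proof -
  obtain R where R: "1 \<le> R" "\<And>y. R \<le> \<bar>y\<bar> \<Longrightarrow> 2 * \<bar>y\<bar> \<le> \<bar>poly p y\<bar>"
    using poly_doubling[OF deg] by metis
  \<comment> \<open>The strict inequality makes these sets open, as the compactness argument
    requires.\<close>
  define U where "U n = {x. R < \<bar>(poly p ^^ n) x\<bar>}" for n
  have "open (U n)" for n
    unfolding U_def
    by (rule open_Collect_less) (intro continuous_intros continuous_on_iterate)+
  moreover have "{- R..R} \<subseteq> (\<Union>n\<in>UNIV. U n)"
    using no_fixed_point_unbounded_orbit[OF assms(2), of R] by (auto simp: U_def)
  ultimately obtain F where F: "finite F" "{- R..R} \<subseteq> (\<Union>n\<in>F. U n)"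
    using compactE_image[of "{- R..R}" UNIV U] by auto
  \<comment> \<open>Inserting 0 provides the entry time of points already outside the interval and
    keeps the maximum defined.\<close>
  have "2 ^ n \<le> 2 ^ Max (insert 0 F) * (1 + \<bar>(poly p ^^ n) x\<bar>)" for n x
  proof -
    obtain m where m: "m \<in> insert 0 F" "R \<le> \<bar>(poly p ^^ m) x\<bar>"
    proof (cases "R \<le> \<bar>x\<bar>")
      case False
      then have "x \<in> {- R..R}" by auto
      then obtain m where "m \<in> F" "x \<in> U m" using F(2) by blast
      then show thesis by (intro that[of m]) (auto simp: U_def)
    qed (use that[of 0] in auto)
    have "m \<le> Max (insert 0 F)" using m(1) F(1) by (intro Max_ge) auto
    then show ?thesis using R m(2) by (intro orbit_growth[of R "poly p" m])
  qed
  then show ?thesis by (intro exI[of _ "Max (insert 0 F)"] allI)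
qed

section \<open>Estimates for iterated weighted compositions\<close>

lemma prod_iterates_le:
  assumes c: "0 < c" "\<And>x. c * (1 + \<bar>x\<bar>)\<^sup>2 \<le> 1 + \<bar>\<phi> x\<bar>"
  shows "c ^ n * (\<Prod>i<n. 1 + \<bar>(\<phi> ^^ i) x\<bar>) \<le> 1 + \<bar>(\<phi> ^^ n) (x :: real)\<bar>"
proof (induction n)
  case (Suc n)
  let ?u = "\<lambda>i. 1 + \<bar>(\<phi> ^^ i) x\<bar>"
  have "c ^ Suc n * (\<Prod>i<Suc n. ?u i) = c * (c ^ n * (\<Prod>i<n. ?u i)) * ?u n" by simp
  \<comment> \<open>One factor of the square comes from the induction hypothesis, the other is the
    new factor of the product.\<close>
  also have "\<dots> \<le> c * ?u n * ?u n"
    using Suc c(1) by (intro mult_right_mono mult_left_mono) auto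
  also have "\<dots> \<le> ?u (Suc n)" using c(2)[of "(\<phi> ^^ n) x"] by (simp add: power2_eq_square mult.assoc)
  finally show ?case .
qed simp

text \<open>The same order \<open>j\<close> occurs on both sides, which allows the estimate to be
  iterated.\<close>

lemma weighted_comp_jet_bound:
  assumes "\<psi> \<in> multipliers"
  shows "\<exists>A\<ge>0. \<exists>r. \<forall>f. smooth f \<longrightarrow> (\<forall>x. (\<Sum>i\<le>j. norm (nth_deriv i (weighted_comp \<psi> (poly p) f) x)) \<le>
           A * (1 + \<bar>x\<bar>) ^ r * (\<Sum>i\<le>j. norm (nth_deriv i f (poly p x))))"
proof (induction j)
  case 0
  then show ?case using weighted_comp_deriv_bound[OF assms, of 0 p] by simp
next
  case (Suc j)
  let ?T = "weighted_comp \<psi> (poly p)"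
  let ?S = "\<lambda>j f x. \<Sum>i\<le>j. norm (nth_deriv i f x)"
  obtain A r where A: "0 \<le> A" "\<And>f x. smooth f \<Longrightarrow> ?S j (?T f) x \<le> A * (1 + \<bar>x\<bar>) ^ r * ?S j f (poly p x)"
    using Suc by blast
  obtain B s where B: "0 \<le> B" "\<And>f x. smooth f \<Longrightarrow>
      norm (nth_deriv (Suc j) (?T f) x) \<le> B * (1 + \<bar>x\<bar>) ^ s * ?S (Suc j) f (poly p x)"
    using weighted_comp_deriv_bound[OF assms, of "Suc j" p] by blast
  have "?S (Suc j) (?T f) x \<le> (A + B) * (1 + \<bar>x\<bar>) ^ (r + s) * ?S (Suc j) f (poly p x)"
    if f: "smooth f" for f x
  proof -
    have "?S (Suc j) (?T f) x \<le> A * (1 + \<bar>x\<bar>) ^ r * ?S j f (poly p x) + B * (1 + \<bar>x\<bar>) ^ s * ?S (Suc j) f (poly p x)"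
      using A(2)[OF f, of x] B(2)[OF f, of x] by (simp only: sum.atMost_Suc[of "\<lambda>i. norm (nth_deriv i (?T f) x)"])
    also have "\<dots> \<le> A * (1 + \<bar>x\<bar>) ^ (r + s) * ?S (Suc j) f (poly p x) + B * (1 + \<bar>x\<bar>) ^ (r + s) * ?S (Suc j) f (poly p x)"
    proof (intro add_mono mult_mono mult_left_mono power_increasing)
      show "?S j f (poly p x) \<le> ?S (Suc j) f (poly p x)" by simp
    qed (use A(1) B(1) in \<open>auto intro!: sum_nonneg mult_nonneg_nonneg add_nonneg_nonneg\<close>)
    finally show ?thesis by (simp only: distrib_right)
  qed
  then show ?case using A(1) B(1) by (intro exI[of _ "A + B"] conjI exI[of _ "r + s"]) auto
qed

lemma weighted_comp_powers_estimate:
  fixes p :: "real poly"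
  assumes deg: "degree p \<ge> 2" and nofix: "\<forall>x. poly p x \<noteq> x" and \<psi>: "\<psi> \<in> multipliers"
  defines "T \<equiv> weighted_comp \<psi> (poly p)"
  assumes T: "T \<in> schwartz_operators"
  shows "\<exists>D\<ge>0. \<exists>K. \<forall>n\<ge>1. \<forall>f\<in>schwartz.
    schwartz_norm k j ((T ^^ n) f) \<le> D * (1 / 2) ^ n * schwartz_norm K j f"
proof -
  let ?S = "\<lambda>f x. \<Sum>i\<le>j. norm (nth_deriv i f x)"
  let ?u = "\<lambda>i x. 1 + \<bar>(poly p ^^ i) x\<bar>"
  obtain A r where A: "0 \<le> A" "\<And>f x. smooth f \<Longrightarrow> ?S (T f) x \<le> A * (1 + \<bar>x\<bar>) ^ r * ?S f (poly p x)"
    using weighted_comp_jet_bound[OF \<psi>, where j = j and p = p] unfolding T_def by blast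
  have Tn: "(T ^^ n) f \<in> schwartz" if "f \<in> schwartz" for n f
    using schwartz_linear_in[OF operators_linear[OF operators_funpow[OF T]] that] .
  \<comment> \<open>The outermost application of \<open>T\<close> moves the point from
    \<open>x\<close> to \<open>poly p x\<close>, so the induction needs \<open>x\<close> arbitrary
    and the product reappears with indices shifted by one.\<close>
  have iter: "?S ((T ^^ n) f) x \<le> A ^ n * (\<Prod>i<n. ?u i x) ^ r * ?S f ((poly p ^^ n) x)"
    if f: "f \<in> schwartz" for n f x
  proof (induction n arbitrary: x)
    case (Suc n)
    have "?S ((T ^^ Suc n) f) x \<le> A * (1 + \<bar>x\<bar>) ^ r * ?S ((T ^^ n) f) (poly p x)"
      using A(2)[OF schwartz_smooth[OF Tn[OF f]]] by simp
    also have "\<dots> \<le> A * (1 + \<bar>x\<bar>) ^ r *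
        (A ^ n * (\<Prod>i<n. ?u i (poly p x)) ^ r * ?S f ((poly p ^^ n) (poly p x)))"
      using A(1) by (intro mult_left_mono Suc.IH) auto
    also have "\<dots> = A ^ Suc n * ((1 + \<bar>x\<bar>) * (\<Prod>i<n. ?u (Suc i) x)) ^ r * ?S f ((poly p ^^ Suc n) x)"
      by (simp only: funpow_Suc_right o_apply power_mult_distrib power_Suc mult_ac)
    also have "(1 + \<bar>x\<bar>) * (\<Prod>i<n. ?u (Suc i) x) = (\<Prod>i<Suc n. ?u i x)"
      unfolding prod.lessThan_Suc_shift by simp
    finally show ?case .
  qed simp
  obtain c where c: "0 < c" "c \<le> 1" "\<And>x. c * (1 + \<bar>x\<bar>)\<^sup>2 \<le> 1 + \<bar>poly p x\<bar>"
    using poly_growth[OF deg] by metis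
  obtain N where N: "\<And>n x. 2 ^ n \<le> 2 ^ N * ?u n x"
    using no_fixed_point_uniform_growth[OF deg nofix] by blast
  \<comment> \<open>Per step, the weight estimate costs a factor \<open>A\<close>, and the product
    bound costs 1/c in each of its \<open>r + k\<close> powers.\<close>
  define B where "B = A / c ^ (r + k)"
  have B: "0 \<le> B" using A(1) c(1) by (simp add: B_def)
  \<comment> \<open>The exponent \<open>s\<close> is the extra power of \<open>?u n x\<close> that
    beats \<open>B ^ n\<close> and still leaves a factor \<open>(1 / 2) ^ n\<close>.\<close>
  obtain s where s: "2 * B \<le> 2 ^ s"
    using real_arch_pow[of 2 "2 * B"] by (auto intro: less_imp_le)
  define D where "D = (2 :: real) ^ (N * s)"
  define K where "K = r + k + s"
  have bound: "(1 + \<bar>x\<bar>) ^ k * ?S ((T ^^ n) f) x \<le> D * (1 / 2) ^ n * schwartz_norm K j f"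
    if n: "n \<ge> 1" and f: "f \<in> schwartz" for n f x
  proof -
    let ?P = "\<Prod>i<n. ?u i x" and ?s = "?S f ((poly p ^^ n) x)"
    have P: "?P \<le> ?u n x / c ^ n" "0 \<le> ?P"
      using prod_iterates_le[OF c(1,3), of n x] c(1) by (auto simp: field_simps intro: prod_nonneg)
    \<comment> \<open>The left side is the factor of index 0, present because n \<ge> 1; all other
      factors are at least 1. The weight at \<open>x\<close> is thereby absorbed into the same
      product.\<close>
    have "1 + \<bar>x\<bar> \<le> ?P"
    proof -
      obtain m where m: "n = Suc m" using n by (cases n) auto
      have "1 \<le> (\<Prod>i<m. ?u (Suc i) x)" by (intro prod_ge_1) auto
      then show ?thesis unfolding m prod.lessThan_Suc_shift
        using mult_left_mono[of 1 "\<Prod>i<m. ?u (Suc i) x" "1 + \<bar>x\<bar>"] by simp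
    qed
    then have "(1 + \<bar>x\<bar>) ^ k * ?S ((T ^^ n) f) x \<le> ?P ^ k * (A ^ n * ?P ^ r * ?s)"
      using A(1) P(2) by (intro mult_mono power_mono iter[OF f] sum_nonneg) auto
    also have "\<dots> = A ^ n * ?P ^ (r + k) * ?s" by (simp add: power_add)
    also have "\<dots> \<le> A ^ n * (?u n x / c ^ n) ^ (r + k) * ?s"
      using A(1) P by (intro mult_right_mono mult_left_mono power_mono sum_nonneg) auto
    also have "\<dots> = B ^ n * ?u n x ^ (r + k) * ?s"
    proof -
      have "A ^ n * (?u n x / c ^ n) ^ (r + k) = B ^ n * ?u n x ^ (r + k)"
        by (simp add: B_def power_divide flip: power_mult) (simp add: mult.commute)
      then show ?thesis by (simp only:)
    qed
    also have "\<dots> \<le> (D * (1 / 2) ^ n * ?u n x ^ s) * ?u n x ^ (r + k) * ?s"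
    proof (intro mult_right_mono)
      \<comment> \<open>This isolates \<open>(2 ^ n) ^ s\<close>, which the uniform growth bounds by
        \<open>(2 ^ N * ?u n x) ^ s\<close>; the part involving \<open>N\<close> is the constant
        \<open>D\<close>.\<close>
      have "B ^ n \<le> (2 ^ s / 2) ^ n" using s B by (intro power_mono) auto
      also have "\<dots> = (1 / 2) ^ n * (2 ^ n) ^ s"
        by (simp add: power_divide flip: power_mult)
      also have "\<dots> \<le> (1 / 2) ^ n * (2 ^ N * ?u n x) ^ s"
        by (intro mult_left_mono power_mono N) auto
      also have "\<dots> = D * (1 / 2) ^ n * ?u n x ^ s"
        by (simp add: D_def power_mult_distrib power_mult)
      finally show "B ^ n \<le> D * (1 / 2) ^ n * ?u n x ^ s" .
    qed (auto intro: sum_nonneg)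
    also have "\<dots> = D * (1 / 2) ^ n * (?u n x ^ K * ?s)"
      by (simp add: K_def power_add mult_ac)
    also have "\<dots> \<le> D * (1 / 2) ^ n * schwartz_norm K j f"
      by (intro mult_left_mono schwartz_norm_upper f) (simp add: D_def)
    finally show ?thesis .
  qed
  have "schwartz_norm k j ((T ^^ n) f) \<le> (real (Suc j) * D) * (1 / 2) ^ n * schwartz_norm K j f"
    if n: "n \<ge> 1" and f: "f \<in> schwartz" for n f
  proof -
    have "schwartz_seminorm k i ((T ^^ n) f) \<le> D * (1 / 2) ^ n * schwartz_norm K j f" if "i \<le> j" for i
    proof (rule schwartz_seminorm_least)
      fix x
      have "norm (nth_deriv i ((T ^^ n) f) x) \<le> ?S ((T ^^ n) f) x"
        using that by (intro member_le_sum) auto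
      then have "(1 + \<bar>x\<bar>) ^ k * norm (nth_deriv i ((T ^^ n) f) x) \<le> (1 + \<bar>x\<bar>) ^ k * ?S ((T ^^ n) f) x"
        by (intro mult_left_mono) auto
      also note bound[OF n f]
      finally show "(1 + \<bar>x\<bar>) ^ k * norm (nth_deriv i ((T ^^ n) f) x) \<le> D * (1 / 2) ^ n * schwartz_norm K j f" .
    qed
    then have "schwartz_norm k j ((T ^^ n) f) \<le> (\<Sum>i\<le>j. D * (1 / 2) ^ n * schwartz_norm K j f)"
      unfolding schwartz_norm_def[of k] by (intro sum_mono) auto
    then show ?thesis by (simp add: mult.assoc)
  qed
  moreover have "0 \<le> real (Suc j) * D" by (simp add: D_def)
  ultimately show ?thesis by blast
qed


section \<open>Consequences of geometric decay of the powers\<close>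

lemma schwartz_sum:
  "finite A \<Longrightarrow> (\<And>i. i \<in> A \<Longrightarrow> f i \<in> schwartz) \<Longrightarrow> (\<lambda>x. \<Sum>i\<in>A. f i x) \<in> schwartz"
  by (induction A rule: finite_induct) (simp_all add: schwartz_zero schwartz_add)

lemma schwartz_norm_sum:
  "finite A \<Longrightarrow> (\<And>i. i \<in> A \<Longrightarrow> f i \<in> schwartz) \<Longrightarrow>
   schwartz_norm k j (\<lambda>x. \<Sum>i\<in>A. f i x) \<le> (\<Sum>i\<in>A. schwartz_norm k j (f i))"
proof (induction A rule: finite_induct)
  case (insert i A)
  have "schwartz_norm k j (\<lambda>x. f i x + (\<Sum>i\<in>A. f i x)) \<le>
      schwartz_norm k j (f i) + schwartz_norm k j (\<lambda>x. \<Sum>i\<in>A. f i x)"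
    using insert.prems insert.hyps by (intro schwartz_norm_add schwartz_sum) auto
  then show ?case using insert by (simp add: order_trans)
qed (simp add: schwartz_norm_zero)

text \<open>The bound may vary with \<open>m\<close>, so that the lemma serves both for geometric
  decay and for powers with a common bound.\<close>

lemma schwartz_norm_cesaro_mean:
  assumes T: "T \<in> schwartz_operators" and f: "f \<in> schwartz"
    and M: "\<And>m. m \<ge> 1 \<Longrightarrow> m \<le> n \<Longrightarrow> schwartz_norm k j ((T ^^ m) f) \<le> M m"
  shows "schwartz_norm k j (cesaro_mean T n f) \<le> (\<Sum>m=1..n. M m) / real n"
proof -
  have Tm: "(T ^^ m) f \<in> schwartz" for m
    by (rule schwartz_linear_in[OF operators_linear[OF operators_funpow[OF T]] f])
  let ?h = "\<lambda>x. \<Sum>m=1..n. (T ^^ m) f x"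
  have "cesaro_mean T n f = (\<lambda>x. (1 / of_nat n) * ?h x)" by (simp add: cesaro_mean_def)
  then have "schwartz_norm k j (cesaro_mean T n f) \<le> norm (1 / of_nat n :: complex) * schwartz_norm k j ?h"
    by (simp only:) (intro schwartz_norm_scale schwartz_sum Tm finite_atLeastAtMost)
  also have "\<dots> \<le> norm (1 / of_nat n :: complex) * (\<Sum>m=1..n. M m)"
    by (intro mult_left_mono order_trans[OF schwartz_norm_sum] sum_mono M Tm) auto
  finally show ?thesis by (simp add: norm_divide)
qed

text \<open>The single property from which all convergence and boundedness statements are deduced.
  The order \<open>j\<close> stays fixed, as in the jet estimate; only the weight exponent
  changes.\<close>

definition geometric_decay :: "real operator \<Rightarrow> bool" where
  "geometric_decay T \<longleftrightarrow> T \<in> schwartz_operators \<and>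
     (\<forall>k j. \<exists>D\<ge>0. \<exists>k'. \<forall>n\<ge>1. \<forall>f\<in>schwartz.
        schwartz_norm k j ((T ^^ n) f) \<le> D * (1 / 2) ^ n * schwartz_norm k' j f)"

lemma geometric_decayD:
  assumes "geometric_decay T"
  obtains D k' where "0 \<le> D"
    "\<forall>n\<ge>1. \<forall>f\<in>schwartz. schwartz_norm k j ((T ^^ n) f) \<le> D * (1 / 2) ^ n * schwartz_norm k' j f"
  using assms unfolding geometric_decay_def by meson

lemma geometric_decay_operator: "geometric_decay T \<Longrightarrow> T \<in> schwartz_operators"
  by (simp add: geometric_decay_def)

lemma sum_half_powers_le: "(\<Sum>m=1..n. (1 / 2 :: real) ^ m) \<le> 1"
proof -
  have "(\<Sum>m=1..n. (1 / 2 :: real) ^ m) = 1 - (1 / 2) ^ n"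
    by (induction n) (simp_all add: field_simps)
  then show ?thesis by simp
qed

lemma geometric_decay_cesaro:
  assumes T: "geometric_decay T"
  obtains D k' where "0 \<le> D"
    "\<forall>n\<ge>1. \<forall>f\<in>schwartz. schwartz_norm k j (cesaro_mean T n f) \<le> D / real n * schwartz_norm k' j f"
proof -
  obtain D k' where D: "0 \<le> D"
    "\<forall>n\<ge>1. \<forall>f\<in>schwartz. schwartz_norm k j ((T ^^ n) f) \<le> D * (1 / 2) ^ n * schwartz_norm k' j f"
    by (rule geometric_decayD[OF T])
  have "schwartz_norm k j (cesaro_mean T n f) \<le> D / real n * schwartz_norm k' j f" if f: "f \<in> schwartz" for n f
  proof -
    let ?q = "schwartz_norm k' j f"
    have "schwartz_norm k j (cesaro_mean T n f) \<le> (\<Sum>m=1..n. D * (1 / 2) ^ m * ?q) / real n"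
      using D(2) f by (intro schwartz_norm_cesaro_mean geometric_decay_operator T) auto
    also have "\<dots> = (\<Sum>m=1..n. (1 / 2) ^ m) * (D / real n * ?q)"
      \<comment> \<open>The geometric sum is split off because it stays below 1; division by
        \<open>n\<close> then leaves the rate 1/n.\<close>
      by (simp add: sum_distrib_left sum_distrib_right sum_divide_distrib mult_ac)
    also have "\<dots> \<le> 1 * (D / real n * ?q)"
      using D(1) schwartz_norm_nonneg[OF f] by (intro mult_right_mono sum_half_powers_le) auto
    finally show ?thesis by simp
  qed
  then show thesis using D(1) that by blast
qed

section \<open>Bounded sets and the forms of convergence\<close>

abbreviation "schwartz_bounded \<equiv> seminorm_bounded schwartz schwartz_seminorms"

lemma schwartz_bounded_bdd:
  assumes "schwartz_bounded B"
  shows "bdd_above (schwartz_seminorm k j ` B)"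
proof -
  have "schwartz_seminorm k j \<in> schwartz_seminorms" by (auto simp: schwartz_seminorms_def)
  then show ?thesis
    using assms[unfolded seminorm_bounded_def, THEN conjunct2, THEN bspec] by simp
qed

lemma schwartz_boundedD:
  assumes "schwartz_bounded B"
  obtains M where "0 \<le> M" "\<forall>f\<in>B. schwartz_norm k j f \<le> M"
proof -
  have "\<exists>M\<ge>0. \<forall>f\<in>B. schwartz_norm k j f \<le> M"
  proof (induction j)
    case 0
    have "bdd_above (schwartz_seminorm k 0 ` B)"
      by (rule schwartz_bounded_bdd[OF assms])
    then obtain M where "\<forall>f\<in>B. schwartz_seminorm k 0 f \<le> M" unfolding bdd_above_def by auto
    then show ?case by (intro exI[of _ "max M 0"]) (auto simp: schwartz_norm_def le_max_iff_disj)
  next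
    case (Suc j)
    then obtain M where M: "0 \<le> M" "\<forall>f\<in>B. schwartz_norm k j f \<le> M" by blast
    have "bdd_above (schwartz_seminorm k (Suc j) ` B)"
      by (rule schwartz_bounded_bdd[OF assms])
    then obtain L where L: "\<forall>f\<in>B. schwartz_seminorm k (Suc j) f \<le> L" unfolding bdd_above_def by auto
    have "schwartz_norm k (Suc j) f \<le> M + max L 0" if "f \<in> B" for f
      unfolding schwartz_norm_Suc using M(2) L that by (intro add_mono) (auto simp: le_max_iff_disj)
    then show ?case using M(1) by (intro exI[of _ "M + max L 0"]) auto
  qed
  then show thesis using that by blast
qed

lemma schwartz_bounded_singleton: "f \<in> schwartz \<Longrightarrow> schwartz_bounded {f}"
  by (simp add: seminorm_bounded_def)

lemma geometric_decay_power_bounded: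
  assumes T: "geometric_decay T"
  shows "power_bounded schwartz schwartz_seminorms T"
  unfolding power_bounded_def equicontinuous_def
proof (intro conjI allI impI)
  show ops: "T \<in> schwartz_operators" "{T ^^ n |n. 1 \<le> n} \<subseteq> schwartz_operators"
    using geometric_decay_operator[OF T] operators_funpow by auto
  fix V assume "openin schwartz_topology V \<and> (\<lambda>x. 0) \<in> V"
  then obtain k j e where e: "0 < e" "{g \<in> schwartz. schwartz_norm k j g < e} \<subseteq> V"
    using openin_schwartz_zeroD by metis
  obtain D k' where D: "0 \<le> D"
    "\<forall>n\<ge>1. \<forall>f\<in>schwartz. schwartz_norm k j ((T ^^ n) f) \<le> D * (1 / 2) ^ n * schwartz_norm k' j f"
    by (rule geometric_decayD[OF T])
  \<comment> \<open>A ball that works for all powers at once; \<open>D + 1\<close> avoids division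
    by zero.\<close>
  let ?U = "{g \<in> schwartz. schwartz_norm k' j g < e / (D + 1)}"
  have "(T ^^ n) f \<in> V" if n: "n \<ge> 1" and f: "f \<in> ?U" for n f
  proof -
    have q: "0 \<le> schwartz_norm k' j f" using f by (simp add: schwartz_norm_nonneg)
    have "schwartz_norm k j ((T ^^ n) f) \<le> D * (1 / 2) ^ n * schwartz_norm k' j f" using D n f by auto
    also have "\<dots> \<le> (D + 1) * 1 * schwartz_norm k' j f"
      using D(1) q by (intro mult_right_mono mult_mono power_le_one) auto
    also have "\<dots> < e" using f D(1) by (simp add: field_simps)
    finally show ?thesis
      using e(2) schwartz_linear_in[OF operators_linear[OF operators_funpow[OF ops(1)]], of f n] f by auto
  qed
  then have "\<forall>S\<in>{T ^^ n |n. 1 \<le> n}. S ` ?U \<subseteq> V" by blast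
  moreover have "(\<lambda>x. 0) \<in> ?U" using e(1) D(1) by (simp add: schwartz_zero schwartz_norm_zero)
  ultimately show "\<exists>U. openin schwartz_topology U \<and> (\<lambda>x. 0) \<in> U \<and> (\<forall>S\<in>{T ^^ n |n. 1 \<le> n}. S ` U \<subseteq> V)"
    using openin_schwartz_ball0[of k' j "e / (D + 1)"] by (intro exI[of _ ?U] conjI)
qed

text \<open>Serves both variants of mean ergodicity, since singletons are bounded. The limit is the
  zero operator.\<close>

lemma geometric_decay_cesaro_eventually:
  assumes T: "geometric_decay T" and B: "schwartz_bounded B"
    and V: "openin schwartz_topology V" "(\<lambda>x. 0) \<in> V"
  shows "\<forall>\<^sub>F n in sequentially. \<forall>f\<in>B. cesaro_mean T n f \<in> V"
proof -
  obtain k j e where e: "0 < e" "{g \<in> schwartz. schwartz_norm k j g < e} \<subseteq> V"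
    using openin_schwartz_zeroD[OF V] by metis
  obtain D k' where D: "0 \<le> D"
    "\<forall>n\<ge>1. \<forall>f\<in>schwartz. schwartz_norm k j (cesaro_mean T n f) \<le> D / real n * schwartz_norm k' j f"
    by (rule geometric_decay_cesaro[OF T])
  obtain M where M: "0 \<le> M" "\<forall>f\<in>B. schwartz_norm k' j f \<le> M" by (rule schwartz_boundedD[OF B])
  have "(\<lambda>n. D * M / real n) \<longlonglongrightarrow> 0" by (rule lim_const_over_n)
  then have "\<forall>\<^sub>F n in sequentially. D * M / real n < e" by (rule order_tendstoD) (rule e(1))
  with eventually_ge_at_top[of 1] show ?thesis
  proof eventually_elim
    case (elim n)
    show ?case
    proof
      fix f assume f: "f \<in> B"
      then have "f \<in> schwartz" using B by (auto simp: seminorm_bounded_def)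
      then have "schwartz_norm k j (cesaro_mean T n f) \<le> D / real n * schwartz_norm k' j f"
        using D(2) elim(1) by blast
      also have "\<dots> \<le> D / real n * M" using D(1) M f by (intro mult_left_mono) auto
      also have "\<dots> < e" using elim(2) by simp
      finally show "cesaro_mean T n f \<in> V"
        using e(2) schwartz_linear_in[OF operators_linear[OF operators_cesaro_mean[OF geometric_decay_operator[OF T]]] \<open>f \<in> schwartz\<close>]
        by blast
    qed
  qed
qed

lemma geometric_decay_uniformly_mean_ergodic:
  assumes T: "geometric_decay T"
  shows "uniformly_mean_ergodic schwartz schwartz_seminorms T"
  unfolding uniformly_mean_ergodic_def
  using geometric_decay_cesaro_eventually[OF T]
  by (intro conjI geometric_decay_operator[OF T] exI[of _ "\<lambda>f x. 0"])
     (auto simp: schwartz_zero fun_diff_def)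

lemma geometric_decay_mean_ergodic:
  assumes T: "geometric_decay T"
  shows "mean_ergodic schwartz schwartz_seminorms T"
  unfolding mean_ergodic_def limitin_def
  using geometric_decay_cesaro_eventually[OF T schwartz_bounded_singleton]
  by (intro conjI geometric_decay_operator[OF T] ballI exI[of _ "\<lambda>x. 0"]) (auto simp: schwartz_zero)

lemma Lb_seminorms_cases:
  assumes "q \<in> Lb_seminorms schwartz schwartz_seminorms"
  obtains B k j where "schwartz_bounded B" "B \<noteq> {}" "q = (\<lambda>T. SUP f\<in>B. schwartz_seminorm k j (T f))"
  using assms unfolding Lb_seminorms_def schwartz_seminorms_def by auto

lemma geometric_decay_powers_tendsto_zero:
  assumes T: "geometric_decay T"
  shows "powers_tendsto_zero schwartz schwartz_seminorms T"
  unfolding powers_tendsto_zero_def limitin_def Lb_topology_def topspace_seminorm_topology openin_seminorm_topology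
proof (intro conjI allI impI geometric_decay_operator[OF T] operators_zero)
  fix U assume "seminorm_open schwartz_operators (Lb_seminorms schwartz schwartz_seminorms) U \<and> (\<lambda>f x. 0) \<in> U"
  then obtain F e where F: "finite F" "F \<subseteq> Lb_seminorms schwartz schwartz_seminorms" "0 < e"
      "{S \<in> schwartz_operators. \<forall>q\<in>F. q (S - (\<lambda>f x. 0)) < e} \<subseteq> U"
    unfolding seminorm_open_def by blast
  \<comment> \<open>A basic neighbourhood involves finitely many seminorms, so each may be treated
    alone.\<close>
  have "\<forall>\<^sub>F n in sequentially. q (T ^^ n - (\<lambda>f x. 0)) < e" if q: "q \<in> F" for q
  proof -
    obtain B k j where B: "schwartz_bounded B" "B \<noteq> {}" "q = (\<lambda>T. SUP f\<in>B. schwartz_seminorm k j (T f))"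
      using q F(2) by (blast elim: Lb_seminorms_cases)
    obtain D k' where D: "0 \<le> D"
      "\<forall>n\<ge>1. \<forall>f\<in>schwartz. schwartz_norm k j ((T ^^ n) f) \<le> D * (1 / 2) ^ n * schwartz_norm k' j f"
      by (rule geometric_decayD[OF T])
    obtain M where M: "0 \<le> M" "\<forall>f\<in>B. schwartz_norm k' j f \<le> M" by (rule schwartz_boundedD[OF B(1)])
    have "(\<lambda>n. D * (1 / 2) ^ n * M) \<longlonglongrightarrow> D * 0 * M" by (intro tendsto_intros LIMSEQ_power_zero) auto
    then have "\<forall>\<^sub>F n in sequentially. D * (1 / 2) ^ n * M < e" by (rule order_tendstoD) (simp add: F(3))
    with eventually_ge_at_top[of 1] show ?thesis
    proof eventually_elim
      case (elim n)
      have "schwartz_seminorm k j ((T ^^ n) f) \<le> D * (1 / 2) ^ n * M" if f: "f \<in> B" for f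
      proof -
        have fS: "f \<in> schwartz" using f B by (auto simp: seminorm_bounded_def)
        have "schwartz_seminorm k j ((T ^^ n) f) \<le> schwartz_norm k j ((T ^^ n) f)"
          by (intro schwartz_seminorm_le_norm order_refl
            schwartz_linear_in[OF operators_linear[OF operators_funpow[OF geometric_decay_operator[OF T]]] fS])
        also have "\<dots> \<le> D * (1 / 2) ^ n * schwartz_norm k' j f" using D(2) elim(1) fS by blast
        also have "\<dots> \<le> D * (1 / 2) ^ n * M" using D(1) M f by (intro mult_left_mono) auto
        finally show ?thesis .
      qed
      then have "q (T ^^ n) \<le> D * (1 / 2) ^ n * M" unfolding B(3) using B(2) by (intro cSUP_least) auto
      then show ?case using elim(2) by (simp add: fun_diff_def)
    qed
  qed
  then have "\<forall>\<^sub>F n in sequentially. \<forall>q\<in>F. q (T ^^ n - (\<lambda>f x. 0)) < e"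
    using F(1) by (intro eventually_ball_finite) auto
  then show "\<forall>\<^sub>F n in sequentially. T ^^ n \<in> U"
    by (rule eventually_mono) (use F(4) operators_funpow[OF geometric_decay_operator[OF T]] in blast)
qed

lemma geometric_decay_cesaro_bounded:
  assumes T: "geometric_decay T"
  shows "cesaro_bounded schwartz schwartz_seminorms T"
  unfolding cesaro_bounded_def Lb_bounded_def seminorm_bounded_def[of schwartz_operators]
proof (intro conjI ballI geometric_decay_operator[OF T])
  show "{cesaro_mean T n |n. 1 \<le> n} \<subseteq> schwartz_operators"
    using operators_cesaro_mean[OF geometric_decay_operator[OF T]] by blast
  fix q assume "q \<in> Lb_seminorms schwartz schwartz_seminorms"
  then obtain B k j where B: "schwartz_bounded B" "B \<noteq> {}" "q = (\<lambda>T. SUP f\<in>B. schwartz_seminorm k j (T f))"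
    by (rule Lb_seminorms_cases)
  obtain D k' where D: "0 \<le> D"
    "\<forall>n\<ge>1. \<forall>f\<in>schwartz. schwartz_norm k j (cesaro_mean T n f) \<le> D / real n * schwartz_norm k' j f"
    by (rule geometric_decay_cesaro[OF T])
  obtain M where M: "0 \<le> M" "\<forall>f\<in>B. schwartz_norm k' j f \<le> M" by (rule schwartz_boundedD[OF B(1)])
  have "q (cesaro_mean T n) \<le> D * M" if n: "n \<ge> 1" for n
    unfolding B(3)
  proof (rule cSUP_least[OF B(2)])
    fix f assume f: "f \<in> B"
    then have fS: "f \<in> schwartz" using B by (auto simp: seminorm_bounded_def)
    have "schwartz_seminorm k j (cesaro_mean T n f) \<le> schwartz_norm k j (cesaro_mean T n f)"
      by (intro schwartz_seminorm_le_norm order_refl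
        schwartz_linear_in[OF operators_linear[OF operators_cesaro_mean[OF geometric_decay_operator[OF T]]] fS])
    also have "\<dots> \<le> D / real n * schwartz_norm k' j f" using D(2) n fS by blast
    also have "\<dots> \<le> D * M"
    proof (rule mult_mono)
      have "D / real n \<le> D / 1" using D(1) n by (intro divide_left_mono) auto
      then show "D / real n \<le> D" by simp
    qed (use D(1) M f schwartz_norm_nonneg[OF fS] in auto)
    finally show "schwartz_seminorm k j (cesaro_mean T n f) \<le> D * M" .
  qed
  then show "bdd_above (q ` {cesaro_mean T n |n. 1 \<le> n})"
    by (intro bdd_aboveI2[of _ _ "D * M"]) auto
qed

section \<open>Obstruction at a fixed point\<close>

text \<open>A weak consequence common to all the conditions: the norm controls the supremum and the
  slope of the means. It is required only eventually, since convergence says nothing about early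
  indices.\<close>

definition cesaro_orbit_bounded :: "real operator \<Rightarrow> bool" where
  "cesaro_orbit_bounded T \<longleftrightarrow>
     (\<forall>f\<in>schwartz. \<exists>M. \<forall>\<^sub>F n in sequentially. schwartz_norm 0 1 (cesaro_mean T n f) \<le> M)"

lemma cesaro_norm_bounded_of_powers:
  assumes T: "T \<in> schwartz_operators" and f: "f \<in> schwartz"
    and M: "\<And>m. m \<ge> 1 \<Longrightarrow> schwartz_norm k j ((T ^^ m) f) \<le> M"
  shows "\<forall>\<^sub>F n in sequentially. schwartz_norm k j (cesaro_mean T n f) \<le> M"
  \<comment> \<open>Index 0 is excluded because there the average of the constant \<open>M\<close>
    is 0 and not \<open>M\<close>.\<close>
  using eventually_ge_at_top[of 1]
proof eventually_elim
  case (elim n)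
  have "schwartz_norm k j (cesaro_mean T n f) \<le> (\<Sum>m=1..n. M) / real n"
    by (rule schwartz_norm_cesaro_mean[OF T f M])
  then show ?case using elim by simp
qed

lemma cesaro_norm_bounded_of_limit:
  assumes T: "T \<in> schwartz_operators" and f: "f \<in> schwartz" and g: "g \<in> schwartz"
    and lim: "\<forall>\<^sub>F n in sequentially. schwartz_norm k j (cesaro_mean T n f - g) < 1"
  shows "\<forall>\<^sub>F n in sequentially. schwartz_norm k j (cesaro_mean T n f) \<le> 1 + schwartz_norm k j g"
  using lim
proof eventually_elim
  case (elim n)
  have c: "cesaro_mean T n f \<in> schwartz"
    by (rule schwartz_linear_in[OF operators_linear[OF operators_cesaro_mean[OF T]] f])
  show ?case
    using schwartz_norm_diff_triangle[OF c g schwartz_zero, of k j] elim by (simp add: fun_diff_def)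
qed

lemma power_bounded_cesaro_orbit_bounded:
  assumes T: "power_bounded schwartz schwartz_seminorms T"
  shows "cesaro_orbit_bounded T"
  unfolding cesaro_orbit_bounded_def
proof
  have ops: "T \<in> schwartz_operators" using T by (simp add: power_bounded_def)
  let ?V = "{g \<in> schwartz. schwartz_norm 0 1 g < 1}"
  have V: "openin schwartz_topology ?V" "(\<lambda>x. 0) \<in> ?V"
    by (rule openin_schwartz_ball0) (simp add: schwartz_zero schwartz_norm_zero)
  obtain U where U: "openin schwartz_topology U" "(\<lambda>x. 0) \<in> U"
      "\<forall>S\<in>{T ^^ n |n. 1 \<le> n}. S ` U \<subseteq> ?V"
    using T V unfolding power_bounded_def equicontinuous_def by blast
  obtain k j e where e: "0 < e" "{g \<in> schwartz. schwartz_norm k j g < e} \<subseteq> U"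
    using openin_schwartz_zeroD[OF U(1,2)] by metis
  fix f :: "real \<Rightarrow> complex" assume f: "f \<in> schwartz"
  \<comment> \<open>By equicontinuity the radius \<open>e\<close> serves all powers, so the constant
    does not depend on \<open>n\<close>.\<close>
  have "schwartz_norm 0 1 ((T ^^ n) f) \<le> 1 / e * schwartz_norm k j f" if n: "n \<ge> 1" for n
  proof (rule schwartz_linear_estimate[OF operators_linear[OF operators_funpow[OF ops]] e(1) _ f])
    fix g :: "real \<Rightarrow> complex" assume "g \<in> schwartz" "schwartz_norm k j g < e"
    then have "g \<in> U" using e(2) by blast
    then have "(T ^^ n) g \<in> ?V" using U(3) n by blast
    then show "schwartz_norm 0 1 ((T ^^ n) g) < 1" by simp
  qed
  then show "\<exists>M. \<forall>\<^sub>F n in sequentially. schwartz_norm 0 1 (cesaro_mean T n f) \<le> M"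
    using cesaro_norm_bounded_of_powers[OF ops f] by blast
qed

lemma mean_ergodic_cesaro_orbit_bounded:
  assumes T: "mean_ergodic schwartz schwartz_seminorms T"
  shows "cesaro_orbit_bounded T"
  unfolding cesaro_orbit_bounded_def
proof
  fix f :: "real \<Rightarrow> complex" assume f: "f \<in> schwartz"
  have ops: "T \<in> schwartz_operators" using T by (simp add: mean_ergodic_def)
  obtain g where g: "limitin schwartz_topology (\<lambda>n. cesaro_mean T n f) g sequentially"
    using T f unfolding mean_ergodic_def by blast
  then have gS: "g \<in> schwartz" by (simp add: limitin_def)
  let ?V = "{h \<in> schwartz. schwartz_norm 0 1 (h - g) < 1}"
  have "g \<in> ?V" using gS by (simp add: fun_diff_def schwartz_norm_zero)
  then have "\<forall>\<^sub>F n in sequentially. cesaro_mean T n f \<in> ?V"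
    using g openin_schwartz_ball[OF gS, of 0 1 1] unfolding limitin_def by blast
  then have "\<forall>\<^sub>F n in sequentially. schwartz_norm 0 1 (cesaro_mean T n f - g) < 1"
    by (rule eventually_mono) blast
  from cesaro_norm_bounded_of_limit[OF ops f gS this]
  show "\<exists>M. \<forall>\<^sub>F n in sequentially. schwartz_norm 0 1 (cesaro_mean T n f) \<le> M" by blast
qed

lemma uniformly_mean_ergodic_cesaro_orbit_bounded:
  assumes T: "uniformly_mean_ergodic schwartz schwartz_seminorms T"
  shows "cesaro_orbit_bounded T"
  unfolding cesaro_orbit_bounded_def
proof
  fix f :: "real \<Rightarrow> complex" assume f: "f \<in> schwartz"
  have ops: "T \<in> schwartz_operators" using T by (simp add: uniformly_mean_ergodic_def)
  obtain S where S: "S ` schwartz \<subseteq> schwartz \<and>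
      (\<forall>B V. schwartz_bounded B \<and> openin schwartz_topology V \<and> (\<lambda>x. 0) \<in> V \<longrightarrow>
        (\<forall>\<^sub>F n in sequentially. \<forall>f\<in>B. cesaro_mean T n f - S f \<in> V))"
    using T[unfolded uniformly_mean_ergodic_def, THEN conjunct2] by (rule exE)
  have gS: "S f \<in> schwartz" using conjunct1[OF S] f by blast
  have "\<forall>\<^sub>F n in sequentially. \<forall>f\<in>{f}. cesaro_mean T n f - S f \<in> {h \<in> schwartz. schwartz_norm 0 1 h < 1}"
    by (rule conjunct2[OF S, rule_format])
       (simp add: schwartz_bounded_singleton f openin_schwartz_ball0 schwartz_zero schwartz_norm_zero)
  then have "\<forall>\<^sub>F n in sequentially. schwartz_norm 0 1 (cesaro_mean T n f - S f) < 1"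
    by (rule eventually_mono) blast
  from cesaro_norm_bounded_of_limit[OF ops f gS this]
  show "\<exists>M. \<forall>\<^sub>F n in sequentially. schwartz_norm 0 1 (cesaro_mean T n f) \<le> M" by blast
qed

text \<open>A singleton is bounded, so evaluation at one function is controlled by the topology of
  uniform convergence on bounded sets.\<close>

lemma Lb_seminorm_point:
  assumes "f \<in> schwartz"
  shows "(\<lambda>T. schwartz_seminorm k j (T f)) \<in> Lb_seminorms schwartz schwartz_seminorms"
proof -
  have "(\<lambda>T. SUP g\<in>{f}. schwartz_seminorm k j (T g)) \<in> Lb_seminorms schwartz schwartz_seminorms"
    unfolding Lb_seminorms_def schwartz_seminorms_def
    using schwartz_bounded_singleton[OF assms, unfolded schwartz_seminorms_def] by blast
  then show ?thesis by simp
qed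

lemma powers_tendsto_zero_cesaro_orbit_bounded:
  assumes T: "powers_tendsto_zero schwartz schwartz_seminorms T"
  shows "cesaro_orbit_bounded T"
  unfolding cesaro_orbit_bounded_def
proof
  fix f :: "real \<Rightarrow> complex" assume f: "f \<in> schwartz"
  have ops: "T \<in> schwartz_operators" using T by (simp add: powers_tendsto_zero_def)
  let ?V = "{S \<in> schwartz_operators. schwartz_norm 0 1 (S f) < 1}"
  have "openin (Lb_topology schwartz schwartz_seminorms) ?V"
    unfolding Lb_topology_def openin_seminorm_topology seminorm_open_def
  proof (intro conjI ballI)
    fix S assume S: "S \<in> ?V"
    \<comment> \<open>The norm consists of the seminorms of orders 0 and 1, and each receives half
      of the remaining distance to 1.\<close>
    let ?F = "(\<lambda>i T. schwartz_seminorm 0 i (T f)) ` {0, 1}"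
    let ?e = "(1 - schwartz_norm 0 1 (S f)) / 2"
    have "schwartz_norm 0 1 (R f) < 1" if R: "R \<in> schwartz_operators" "\<forall>q\<in>?F. q (R - S) < ?e" for R
    proof -
      have RS: "R f \<in> schwartz" "S f \<in> schwartz"
        using schwartz_linear_in[OF operators_linear f, of R] schwartz_linear_in[OF operators_linear f, of S] R S
        by auto
      have "schwartz_norm 0 1 (R f - S f) < ?e + ?e"
        using R(2) unfolding schwartz_norm_def by (simp del: sum_divide_distrib)
      then show ?thesis
        using schwartz_norm_diff_triangle[OF RS schwartz_zero, of 0 1] by (simp add: fun_diff_def)
    qed
    then show "\<exists>F e. finite F \<and> F \<subseteq> Lb_seminorms schwartz schwartz_seminorms \<and> 0 < e \<and>
        {R \<in> schwartz_operators. \<forall>q\<in>F. q (R - S) < e} \<subseteq> ?V"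
      using S Lb_seminorm_point[OF f] by (intro exI[of _ ?F] exI[of _ ?e]) auto
  qed auto
  moreover have "(\<lambda>f x. 0) \<in> ?V" by (simp add: operators_zero schwartz_norm_zero)
  ultimately have "\<forall>\<^sub>F n in sequentially. T ^^ n \<in> ?V"
    using T unfolding powers_tendsto_zero_def limitin_def by blast
  then obtain N where N: "\<And>n. n \<ge> N \<Longrightarrow> schwartz_norm 0 1 ((T ^^ n) f) < 1"
    unfolding eventually_sequentially by blast
  \<comment> \<open>Convergence controls only the powers from \<open>N\<close> on; the finitely many
    earlier norms are added to the bound.\<close>
  have "schwartz_norm 0 1 ((T ^^ n) f) \<le> 1 + (\<Sum>m<N. schwartz_norm 0 1 ((T ^^ m) f))" for n
  proof -
    have nonneg: "0 \<le> schwartz_norm 0 1 ((T ^^ m) f)" for m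
      by (rule schwartz_norm_nonneg[OF schwartz_linear_in[OF operators_linear[OF operators_funpow[OF ops]] f]])
    show ?thesis
    proof (cases "n < N")
      case True
      then have "schwartz_norm 0 1 ((T ^^ n) f) \<le> (\<Sum>m<N. schwartz_norm 0 1 ((T ^^ m) f))"
        using nonneg by (intro member_le_sum) auto
      then show ?thesis by simp
    next
      case False
      then show ?thesis
        using N[of n] sum_nonneg[of "{..<N}" "\<lambda>m. schwartz_norm 0 1 ((T ^^ m) f)"] nonneg by auto
    qed
  qed
  then show "\<exists>M. \<forall>\<^sub>F n in sequentially. schwartz_norm 0 1 (cesaro_mean T n f) \<le> M"
    using cesaro_norm_bounded_of_powers[OF ops f] by blast
qed

lemma cesaro_bounded_cesaro_orbit_bounded:
  assumes T: "cesaro_bounded schwartz schwartz_seminorms T"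
  shows "cesaro_orbit_bounded T"
  unfolding cesaro_orbit_bounded_def
proof
  fix f :: "real \<Rightarrow> complex" assume f: "f \<in> schwartz"
  have "\<exists>M. \<forall>n\<ge>1. schwartz_seminorm 0 i (cesaro_mean T n f) \<le> M" for i
  proof -
    have "bdd_above ((\<lambda>T. schwartz_seminorm 0 i (T f)) ` {cesaro_mean T n |n. 1 \<le> n})"
      using T[unfolded cesaro_bounded_def Lb_bounded_def seminorm_bounded_def, THEN conjunct2,
          THEN conjunct2, THEN bspec, OF Lb_seminorm_point[OF f, of 0 i]] .
    then obtain M where M: "\<forall>x\<in>(\<lambda>T. schwartz_seminorm 0 i (T f)) ` {cesaro_mean T n |n. 1 \<le> n}. x \<le> M"
      unfolding bdd_above_def by (rule exE)
    have "schwartz_seminorm 0 i (cesaro_mean T n f) \<le> M" if "n \<ge> 1" for n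
      by (rule bspec[OF M]) (use that in blast)
    then show ?thesis by blast
  qed
  then obtain M where M: "\<And>i n. n \<ge> 1 \<Longrightarrow> schwartz_seminorm 0 i (cesaro_mean T n f) \<le> M i" by metis
  have "schwartz_norm 0 1 (cesaro_mean T n f) \<le> M 0 + M 1" if "n \<ge> 1" for n
    using M[OF that, of 0] M[OF that, of 1] by (simp add: schwartz_norm_def)
  then show "\<exists>M. \<forall>\<^sub>F n in sequentially. schwartz_norm 0 1 (cesaro_mean T n f) \<le> M"
    unfolding eventually_sequentially by blast
qed


section \<open>Compositions weighted by multipliers\<close>

lemma one_multiplier: "(\<lambda>x. 1) \<in> multipliers"
  using multipliers_poly[of 1] by simp

lemma multiplier_weighted_comp_operator:
  assumes "degree p \<ge> 2" "\<psi> \<in> multipliers"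
  shows "weighted_comp \<psi> (poly p) \<in> schwartz_operators"
proof -
  obtain c where c: "0 < c" "c \<le> 1" "\<And>x. c * (1 + \<bar>x\<bar>)\<^sup>2 \<le> 1 + \<bar>poly p x\<bar>"
    using poly_growth[OF assms(1)] by metis
  have "1 + \<bar>x\<bar> \<le> 1 / c * (1 + \<bar>poly p x\<bar>)" for x
  proof -
    have "(1 + \<bar>x\<bar>) ^ 1 \<le> (1 + \<bar>x\<bar>)\<^sup>2" by (intro power_increasing) auto
    also have "\<dots> = 1 / c * (c * (1 + \<bar>x\<bar>)\<^sup>2)" using c(1) by simp
    also have "\<dots> \<le> 1 / c * (1 + \<bar>poly p x\<bar>)" using c(1) by (intro mult_left_mono c) auto
    finally show ?thesis by simp
  qed
  then show ?thesis by (rule weighted_comp_operator[OF assms(2)])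
qed

lemma multiplier_geometric_decay:
  assumes "degree p \<ge> 2" "\<forall>x. poly p x \<noteq> x" "\<psi> \<in> multipliers"
  shows "geometric_decay (weighted_comp \<psi> (poly p))"
  unfolding geometric_decay_def
  using multiplier_weighted_comp_operator[OF assms(1,3)]
    weighted_comp_powers_estimate[OF assms multiplier_weighted_comp_operator[OF assms(1,3)]]
  by (intro conjI allI)

section \<open>Bounded orbits and the slope of Cesaro means\<close>

lemma lipschitz_of_deriv1_bound:
  assumes "smooth f" "\<And>x. norm (deriv1 f x) \<le> M"
  shows "norm (f x - f y) \<le> M * \<bar>x - y\<bar>"
proof -
  have "norm (f x - f y) \<le> M * norm (x - y)"
  proof (rule differentiable_bound[where S = UNIV and f' = "\<lambda>x h. h *\<^sub>R deriv1 f x"])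
    show "(f has_derivative (\<lambda>h. h *\<^sub>R deriv1 f x)) (at x within UNIV)" for x
      using smooth_has_vd[OF assms(1)] by (simp add: has_vector_derivative_def)
    show "onorm (\<lambda>h. h *\<^sub>R deriv1 f x) \<le> M" for x
    proof (rule onorm_le)
      show "norm (h *\<^sub>R deriv1 f x) \<le> M * norm h" for h
        using mult_right_mono[OF assms(2)[of x], of "\<bar>h\<bar>"] by (simp add: mult.commute)
    qed
  qed auto
  then show ?thesis by simp
qed

lemma comp_op_funpow: "(comp_op \<phi> ^^ n) f x = f ((\<phi> ^^ n) x)"
proof (induction n arbitrary: x)
  case (Suc n)
  have "(comp_op \<phi> ^^ Suc n) f x = (comp_op \<phi> ^^ n) f (\<phi> x)"
    by (simp add: comp_op_def weighted_comp_def)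
  then show ?case using Suc by (simp add: funpow_swap1)
qed simp

text \<open>The points whose whole orbit stays in [-R, R] form a compact set containing the fixed
  point, and b is its maximum. Any point to the right leaves the interval and is doubled from then
  on; the exit time may depend on the point.\<close>

lemma fixed_point_orbit_boundary:
  fixes p :: "real poly"
  assumes deg: "degree p \<ge> 2" and x0: "poly p x0 = x0"
  obtains R b where "\<And>n. \<bar>(poly p ^^ n) b\<bar> \<le> R"
    and "\<And>x. b < x \<Longrightarrow> \<exists>N. \<forall>n. 2 ^ n \<le> 2 ^ N * (1 + \<bar>(poly p ^^ n) x\<bar>)"
proof -
  obtain R where R: "1 \<le> R" "\<And>y. R \<le> \<bar>y\<bar> \<Longrightarrow> 2 * \<bar>y\<bar> \<le> \<bar>poly p y\<bar>"
    using poly_doubling[OF deg] by metis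
  define K where "K = {x. \<forall>n. \<bar>(poly p ^^ n) x\<bar> \<le> R}"
  have "(poly p ^^ n) x0 = x0" for n by (induction n) (simp_all add: x0)
  \<comment> \<open>Outside the interval absolute values at least double, which a nonzero fixed
    point cannot do.\<close>
  moreover have "\<bar>x0\<bar> \<le> R" using R(2)[of x0] R(1) x0 by (cases "R \<le> \<bar>x0\<bar>") auto
  ultimately have "x0 \<in> K" by (simp add: K_def)
  then have "K \<noteq> {}" by blast
  moreover have bdd: "bdd_above K"
  proof (rule bdd_aboveI)
    fix x assume "x \<in> K"
    then have "\<bar>(poly p ^^ 0) x\<bar> \<le> R" unfolding K_def by blast
    then show "x \<le> R" by simp
  qed
  moreover have "closed K"
    unfolding K_def
    by (intro closed_Collect_all closed_Collect_le continuous_intros continuous_on_iterate)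
  ultimately have "Sup K \<in> K" by (rule closed_contains_Sup)
  moreover have "\<exists>N. \<forall>n. 2 ^ n \<le> 2 ^ N * (1 + \<bar>(poly p ^^ n) x\<bar>)" if "Sup K < x" for x
  proof -
    have "x \<notin> K" using that cSup_upper[OF _ bdd, of x] by auto
    then obtain N where N: "R \<le> \<bar>(poly p ^^ N) x\<bar>" by (auto simp: K_def not_le intro: less_imp_le)
    have "2 ^ n \<le> 2 ^ N * (1 + \<bar>(poly p ^^ n) x\<bar>)" for n
      using R N by (intro orbit_growth[of R "poly p" N]) auto
    then show ?thesis by blast
  qed
  ultimately show thesis by (intro that[of "Sup K" R]) (auto simp: K_def)
qed

lemma fixed_point_not_cesaro_orbit_bounded:
  fixes p :: "real poly"
  assumes deg: "degree p \<ge> 2" and x0: "poly p x0 = x0"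
  shows "\<not> cesaro_orbit_bounded (comp_op (poly p))"
proof
  let ?T = "comp_op (poly p)" and ?g = "poly_gauss 1 0"
  assume "cesaro_orbit_bounded ?T"
  then obtain M where M: "\<forall>\<^sub>F n in sequentially. schwartz_norm 0 1 (cesaro_mean ?T n ?g) \<le> M"
    using poly_gauss_schwartz unfolding cesaro_orbit_bounded_def by blast
  have T: "?T \<in> schwartz_operators"
    unfolding comp_op_def by (rule multiplier_weighted_comp_operator[OF deg one_multiplier])
  obtain R b where b: "\<And>n. \<bar>(poly p ^^ n) b\<bar> \<le> R"
    and escape: "\<And>x. b < x \<Longrightarrow> \<exists>N. \<forall>n. 2 ^ n \<le> 2 ^ N * (1 + \<bar>(poly p ^^ n) x\<bar>)"
    using fixed_point_orbit_boundary[OF deg x0] by metis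
  define s where "s n x = (\<Sum>m=1..n. exp (- ((poly p ^^ m) x)\<^sup>2)) / real n" for n x
  have mean: "cesaro_mean ?T n ?g x = of_real (s n x)" for n x
    by (simp add: cesaro_mean_def s_def comp_op_funpow poly_gauss_def)
  define c where "c = exp (- R\<^sup>2)"
  have c: "0 < c" by (simp add: c_def)
  have low: "c \<le> s n b" if "n \<ge> 1" for n
  proof -
    have "c \<le> exp (- ((poly p ^^ m) b)\<^sup>2)" for m
      unfolding c_def using power_mono[OF b[of m], of 2] by simp
    then have "(\<Sum>m=1..n. c) \<le> (\<Sum>m=1..n. exp (- ((poly p ^^ m) b)\<^sup>2))" by (intro sum_mono)
    then show ?thesis using that by (simp add: s_def field_simps)
  qed
  \<comment> \<open>So close to \<open>b\<close> that a slope of at most \<open>M\<close> allows a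
    change of at most c/4, whereas the values at \<open>b\<close> and \<open>x\<close> will differ
    by more than c/2. The choice is independent of \<open>n\<close>.\<close>
  define x where "x = b + c / (4 * (\<bar>M\<bar> + 1))"
  have "b < x" using c by (simp add: x_def)
  then obtain N where N: "\<And>n. 2 ^ n \<le> 2 ^ N * (1 + \<bar>(poly p ^^ n) x\<bar>)" using escape by blast
  \<comment> \<open>Since (1 + |y|) exp(-y^2) \<le> e, the escape estimate makes the terms
    geometrically small, and their average is of order 1/n.\<close>
  have up: "s n x \<le> 2 ^ N * exp 1 / real n" for n
  proof -
    have "exp (- ((poly p ^^ m) x)\<^sup>2) \<le> 2 ^ N * exp 1 * (1 / 2) ^ m" for m
    proof -
      let ?y = "(poly p ^^ m) x"
      have "2 ^ m * exp (- ?y\<^sup>2) \<le> 2 ^ N * (1 + \<bar>?y\<bar>) * exp (- ?y\<^sup>2)" by (intro mult_right_mono N) auto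
      also have "\<dots> \<le> 2 ^ N * exp 1" using power_gauss_bound[of ?y 1] by simp
      finally show ?thesis by (simp add: power_divide field_simps)
    qed
    then have "(\<Sum>m=1..n. exp (- ((poly p ^^ m) x)\<^sup>2)) \<le> (\<Sum>m=1..n. 2 ^ N * exp 1 * (1 / 2) ^ m)"
      by (intro sum_mono)
    also have "\<dots> \<le> 2 ^ N * exp 1 * 1"
      unfolding sum_distrib_left[symmetric] by (intro mult_left_mono sum_half_powers_le) auto
    finally show ?thesis unfolding s_def by (intro divide_right_mono) auto
  qed
  have "(\<lambda>n. 2 ^ N * exp 1 / real n) \<longlonglongrightarrow> 0" by (rule lim_const_over_n)
  then have "\<forall>\<^sub>F n in sequentially. 2 ^ N * exp 1 / real n < c / 2" by (rule order_tendstoD) (use c in simp)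
  with M eventually_ge_at_top[of 1] have "\<forall>\<^sub>F n in sequentially. False"
  proof eventually_elim
    case (elim n)
    let ?h = "cesaro_mean ?T n ?g"
    have h: "?h \<in> schwartz"
      by (rule schwartz_linear_in[OF operators_linear[OF operators_cesaro_mean[OF T]] poly_gauss_schwartz])
    have "norm (deriv1 ?h y) \<le> M" for y
    proof -
      have "norm (nth_deriv 1 ?h y) \<le> (\<Sum>i\<le>1. norm (nth_deriv i ?h y))" by (intro member_le_sum) auto
      also have "\<dots> \<le> schwartz_norm 0 1 ?h" using schwartz_norm_upper[OF h, where k = 0 and j = 1] by simp
      finally show ?thesis using elim(1) by (simp add: nth_deriv_Suc)
    qed
    then have "norm (?h b - ?h x) \<le> M * \<bar>b - x\<bar>" by (rule lipschitz_of_deriv1_bound[OF schwartz_smooth[OF h]])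
    then have "\<bar>s n b - s n x\<bar> \<le> M * \<bar>b - x\<bar>" unfolding mean by (metis norm_of_real of_real_diff)
    also have "\<dots> \<le> (\<bar>M\<bar> + 1) * \<bar>b - x\<bar>" by (intro mult_right_mono) auto
    also have "\<dots> = c / 4"
    proof -
      have "d * (c / (4 * d)) = c / 4" if "d > 0" for d :: real using that by simp
      from this[of "\<bar>M\<bar> + 1"] show ?thesis using c by (simp add: x_def abs_of_nonneg add_nonneg_pos)
    qed
    finally show False using low[OF elim(2)] up[of n] elim(3) c by linarith
  qed
  then show False by simp
qed

section \<open>The symbol classes and the equivalences\<close>

lemma small_decay_symbols_subset_multipliers: "small_decay_symbols (poly p) \<subseteq> multipliers"
  unfolding small_decay_symbols_def small_decay_def using operator_symbol_multiplier by blast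

text \<open>Puts the unweighted operator among those with symbols of small decay, so that the
  obstruction at a fixed point applies to this class. The exponent 1 works because both weights are
  at least 1.\<close>

lemma one_small_decay_symbol:
  assumes "degree p \<ge> 2"
  shows "(\<lambda>x. 1) \<in> small_decay_symbols (poly p)"
proof -
  have "1 \<le> (INF x\<in>{x::real. 1 \<le> \<bar>x\<bar>}. (1 + \<bar>x\<bar>) powr 1 * (1 + \<bar>poly p x\<bar>) powr 1 * norm (1::complex))"
  proof (rule cINF_greatest)
    have "(1::real) \<in> {x. 1 \<le> \<bar>x\<bar>}" by simp
    then show "{x::real. 1 \<le> \<bar>x\<bar>} \<noteq> {}" by blast
    show "1 \<le> (1 + \<bar>x\<bar>) powr 1 * (1 + \<bar>poly p x\<bar>) powr 1 * norm (1::complex)" for x :: real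
      using mult_mono[of 1 "1 + \<bar>x\<bar>" 1 "1 + \<bar>poly p x\<bar>"] by simp
  qed
  then have "small_decay (poly p) (\<lambda>x. 1)"
    using one_multiplier unfolding small_decay_def multipliers_iff
    by (intro conjI exI[of _ 1]) auto
  then show ?thesis
    using multiplier_weighted_comp_operator[OF assms one_multiplier] by (simp add: small_decay_symbols_def)
qed

text \<open>The variants expressed by "and/or" are the three choices of \<Psi>: either class of
  symbols, or their union.\<close>

theorem theorem5p10:
  fixes p :: "real poly" and \<phi> :: "real \<Rightarrow> real"
  assumes "\<phi> = poly p" and "degree p \<ge> 2"
  shows "((\<forall>x. \<phi> x \<noteq> x) \<longrightarrow> even (degree p)) \<and>
    ((\<forall>x. \<phi> x \<noteq> x) \<longleftrightarrow> power_bounded schwartz schwartz_seminorms (comp_op \<phi>)) \<and>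
    ((\<forall>x. \<phi> x \<noteq> x) \<longleftrightarrow> mean_ergodic schwartz schwartz_seminorms (comp_op \<phi>)) \<and>
    ((\<forall>x. \<phi> x \<noteq> x) \<longleftrightarrow> uniformly_mean_ergodic schwartz schwartz_seminorms (comp_op \<phi>)) \<and>
    ((\<forall>x. \<phi> x \<noteq> x) \<longleftrightarrow> powers_tendsto_zero schwartz schwartz_seminorms (comp_op \<phi>)) \<and>
    ((\<forall>x. \<phi> x \<noteq> x) \<longleftrightarrow> cesaro_bounded schwartz schwartz_seminorms (comp_op \<phi>)) \<and>
    (\<forall>\<Psi> \<in> {multipliers, small_decay_symbols \<phi>, multipliers \<union> small_decay_symbols \<phi>}.
      ((\<forall>x. \<phi> x \<noteq> x) \<longleftrightarrow>
        (\<forall>\<psi>\<in>\<Psi>. power_bounded schwartz schwartz_seminorms (weighted_comp \<psi> \<phi>))) \<and>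
      ((\<forall>x. \<phi> x \<noteq> x) \<longleftrightarrow>
        (\<forall>\<psi>\<in>\<Psi>. powers_tendsto_zero schwartz schwartz_seminorms (weighted_comp \<psi> \<phi>))) \<and>
      ((\<forall>x. \<phi> x \<noteq> x) \<longleftrightarrow>
        (\<forall>\<psi>\<in>\<Psi>. mean_ergodic schwartz schwartz_seminorms (weighted_comp \<psi> \<phi>))) \<and>
      ((\<forall>x. \<phi> x \<noteq> x) \<longleftrightarrow>
        (\<forall>\<psi>\<in>\<Psi>. uniformly_mean_ergodic schwartz schwartz_seminorms (weighted_comp \<psi> \<phi>))))"
proof -
  note deg = assms(2)
  \<comment> \<open>A condition X implied by geometric decay and implying bounded Cesaro orbits is
    equivalent to the absence of fixed points, over any class of multipliers containing the constant
    1.\<close>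
  have iff: "(\<forall>x. \<phi> x \<noteq> x) \<longleftrightarrow> (\<forall>\<psi>\<in>\<Psi>. X (weighted_comp \<psi> \<phi>))"
    if X: "\<And>T. geometric_decay T \<Longrightarrow> X T" "\<And>T. X T \<Longrightarrow> cesaro_orbit_bounded T"
      and \<Psi>: "\<Psi> \<subseteq> multipliers" "(\<lambda>x. 1) \<in> \<Psi>" for X \<Psi>
  proof
    assume "\<forall>x. \<phi> x \<noteq> x"
    then show "\<forall>\<psi>\<in>\<Psi>. X (weighted_comp \<psi> \<phi>)"
      using multiplier_geometric_decay[OF deg] \<Psi>(1) assms(1) by (auto intro!: X(1))
  next
    assume "\<forall>\<psi>\<in>\<Psi>. X (weighted_comp \<psi> \<phi>)"
    then have "cesaro_orbit_bounded (comp_op \<phi>)" using \<Psi>(2) X(2) by (auto simp: comp_op_def)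
    then show "\<forall>x. \<phi> x \<noteq> x" using fixed_point_not_cesaro_orbit_bounded[OF deg] assms(1) by blast
  qed
  \<comment> \<open>The unweighted conditions are the case of the class whose only symbol is the
    constant 1.\<close>
  have comp: "(\<forall>x. \<phi> x \<noteq> x) \<longleftrightarrow> X (comp_op \<phi>)"
    if X: "\<And>T. geometric_decay T \<Longrightarrow> X T" "\<And>T. X T \<Longrightarrow> cesaro_orbit_bounded T" for X
    using iff[where \<Psi> = "{\<lambda>x. 1}", OF X] one_multiplier by (simp add: comp_op_def)
  have \<Psi>: "\<Psi> \<subseteq> multipliers \<and> (\<lambda>x. 1) \<in> \<Psi>"
    if "\<Psi> \<in> {multipliers, small_decay_symbols \<phi>, multipliers \<union> small_decay_symbols \<phi>}" for \<Psi>
    using that small_decay_symbols_subset_multipliers[of p] one_small_decay_symbol[OF deg] one_multiplier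
    unfolding assms(1) by auto
  note power_bounded = geometric_decay_power_bounded power_bounded_cesaro_orbit_bounded
  note mean_ergodic = geometric_decay_mean_ergodic mean_ergodic_cesaro_orbit_bounded
  note uniformly_mean_ergodic = geometric_decay_uniformly_mean_ergodic uniformly_mean_ergodic_cesaro_orbit_bounded
  note tendsto_zero = geometric_decay_powers_tendsto_zero powers_tendsto_zero_cesaro_orbit_bounded
  note cesaro_bounded = geometric_decay_cesaro_bounded cesaro_bounded_cesaro_orbit_bounded
  show ?thesis
  proof (intro conjI ballI)
    show "(\<forall>x. \<phi> x \<noteq> x) \<longrightarrow> even (degree p)"
      using no_fixed_point_even_degree[OF deg] assms(1) by blast
    show "(\<forall>x. \<phi> x \<noteq> x) \<longleftrightarrow> power_bounded schwartz schwartz_seminorms (comp_op \<phi>)"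
      by (rule comp[OF power_bounded])
    show "(\<forall>x. \<phi> x \<noteq> x) \<longleftrightarrow> mean_ergodic schwartz schwartz_seminorms (comp_op \<phi>)"
      by (rule comp[OF mean_ergodic])
    show "(\<forall>x. \<phi> x \<noteq> x) \<longleftrightarrow> uniformly_mean_ergodic schwartz schwartz_seminorms (comp_op \<phi>)"
      by (rule comp[OF uniformly_mean_ergodic])
    show "(\<forall>x. \<phi> x \<noteq> x) \<longleftrightarrow> powers_tendsto_zero schwartz schwartz_seminorms (comp_op \<phi>)"
      by (rule comp[OF tendsto_zero])
    show "(\<forall>x. \<phi> x \<noteq> x) \<longleftrightarrow> cesaro_bounded schwartz schwartz_seminorms (comp_op \<phi>)"
      by (rule comp[OF cesaro_bounded])
    fix \<Psi> assume "\<Psi> \<in> {multipliers, small_decay_symbols \<phi>, multipliers \<union> small_decay_symbols \<phi>}"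
    note \<Psi> = \<Psi>[OF this, THEN conjunct1] \<Psi>[OF this, THEN conjunct2]
    show "(\<forall>x. \<phi> x \<noteq> x) \<longleftrightarrow>
        (\<forall>\<psi>\<in>\<Psi>. power_bounded schwartz schwartz_seminorms (weighted_comp \<psi> \<phi>))"
      by (rule iff[OF power_bounded \<Psi>])
    show "(\<forall>x. \<phi> x \<noteq> x) \<longleftrightarrow>
        (\<forall>\<psi>\<in>\<Psi>. powers_tendsto_zero schwartz schwartz_seminorms (weighted_comp \<psi> \<phi>))"
      by (rule iff[OF tendsto_zero \<Psi>])
    show "(\<forall>x. \<phi> x \<noteq> x) \<longleftrightarrow>
        (\<forall>\<psi>\<in>\<Psi>. mean_ergodic schwartz schwartz_seminorms (weighted_comp \<psi> \<phi>))"
      by (rule iff[OF mean_ergodic \<Psi>])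
    show "(\<forall>x. \<phi> x \<noteq> x) \<longleftrightarrow>
        (\<forall>\<psi>\<in>\<Psi>. uniformly_mean_ergodic schwartz schwartz_seminorms (weighted_comp \<psi> \<phi>))"
      by (rule iff[OF uniformly_mean_ergodic \<Psi>])
  qed
qed

end
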